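(* Suppose $\mathcal{O}$ and $\mathcal{P}$ are enrichable patterns, with structure maps $|\cdot|_{\mathcal{O}}\colon\mathcal{O}\to\mathbb{F}_*^{\natural}$ and $|\cdot|_{\mathcal{P}}\colon\mathcal{P}\to\mathbb{F}_*^{\natural}$. Then the map $$|\cdot|_{\mathcal{O}}\wedge|\cdot|_{\mathcal{P}}\colon\mathcal{O}\times\mathcal{P}\to\mathbb{F}_*^{\natural}$$ makes $\mathcal{O}\times\mathcal{P}$ an enrichable pattern, and $(\mathcal{O}\times\mathcal{P})^{\flat}\simeq\mathcal{O}^{\flat}\times\mathcal{P}^{\flat}$.
   Context: An algebraic pattern is an $\infty$-category $\mathcal{O}$ with a factorization system in which each map factors as an inert map followed by an active map, together with a full subcategory $\mathcal{O}^{\mathrm{el}} \subseteq \mathcal{O}^{\mathrm{int}}$ of elementary objects, where $\mathcal{O}^{\mathrm{int}}$ is the wide subcategory of inert maps. A morphism of patterns is a functor preserving inert maps, active maps and elementary objects. Set $\mathcal{O}^{\mathrm{el}}_{O/} := \mathcal{O}^{\mathrm{el}}\times_{\mathcal{O}^{\mathrm{int}}}\mathcal{O}^{\mathrm{int}}_{O/}$. $\mathbb{F}_*$ is the category of finite pointed sets $\langle n\rangle=(\{0,\dots,n\},0)$; a map is inert if it is an isomorphism away from the base point, active if only the base point is sent to the base point. $\mathbb{F}_*^{\flat}$ has $\langle 1\rangle$ as only elementary object, $\mathbb{F}_*^{\natural}$ has elementary objects $\langle 0\rangle,\langle 1\rangle$. A cartesian pattern is a pattern with a morphism of patterns $|\cdot|\colon\mathcal{O}\to\mathbb{F}_*^{\flat}$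 such that $\mathcal{O}^{\mathrm{el}}_{O/}\to(\mathbb{F}_*^{\flat})^{\mathrm{el}}_{|O|/}$ is an equivalence for all $O$. An enrichable pattern is a pattern $\mathcal{O}$ with a morphism of patterns $|\cdot|_{\mathcal{O}}$ to $\mathbb{F}_*^{\natural}$ such that $\mathcal{O}^{\flat}$ (the same $\infty$-category and factorization system, with only those elementary objects that lie over $\langle 1\rangle$) is a cartesian pattern. The product $\mathcal{O}\times\mathcal{P}$ of patterns has as inert (active) morphisms those whose two components are inert (active), and elementary objects $\mathcal{O}^{\mathrm{el}}\times\mathcal{P}^{\mathrm{el}}$. $\wedge\colon\mathbb{F}_*\times\mathbb{F}_*\to\mathbb{F}_*$ is the smash product of pointed finite sets, $(S,s)\wedge(T,t)=(S\times T)/(\{s\}\times T\cup S\times\{t\})$, so $\langle m\rangle\wedge\langle n\rangle=\langle mn\rangle$; it is a morphism of patterns $\mathbb{F}_*^\natural\times\mathbb{F}_*^\natural\to\mathbb{F}_*^\natural$. *)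

theory Defs
  imports Main "HOL-Library.FuncSet"
begin

section \<open>Simplicial sets\<close>

text \<open>
  A morphism \<open>[m] \<rightarrow> [n]\<close> of the simplex category is the weakly increasing list of its
  \<open>m + 1\<close> values.  The composite of \<open>\<phi> : [l] \<rightarrow> [m]\<close> with \<open>\<theta> : [m] \<rightarrow> [n]\<close> is
  \<open>map (nth \<theta>) \<phi>\<close>.
\<close>

definition simplex_ops :: "nat \<Rightarrow> nat \<Rightarrow> nat list set" where
  "simplex_ops m n = {\<theta>. length \<theta> = Suc m \<and> sorted \<theta> \<and> set \<theta> \<subseteq> {..n}}"

text \<open>
  \<open>Op X n \<theta>\<close> is the restriction \<open>X n \<rightarrow> X m\<close> along \<open>\<theta> : [m] \<rightarrow> [n]\<close>; thus \<open>Op X n [i] x\<close> and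
  \<open>Op X n [i, j] x\<close> are the vertices and edges of an \<open>n\<close>-simplex \<open>x\<close>.  As elements of the
  carrier type may occur in several dimensions, the dimension is always an explicit argument.
\<close>

record 'a sset =
  Simp :: "nat \<Rightarrow> 'a set"
  Op :: "nat \<Rightarrow> nat list \<Rightarrow> 'a \<Rightarrow> 'a"

definition simplicial_set :: "'a sset \<Rightarrow> bool" where
  "simplicial_set X \<longleftrightarrow>
     (\<forall>m n. \<forall>\<theta>\<in>simplex_ops m n. \<forall>x\<in>Simp X n. Op X n \<theta> x \<in> Simp X m) \<and>
     (\<forall>n. \<forall>x\<in>Simp X n. Op X n [0..<Suc n] x = x) \<and>
     (\<forall>l m n. \<forall>\<phi>\<in>simplex_ops l m. \<forall>\<theta>\<in>simplex_ops m n. \<forall>x\<in>Simp X n.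
        Op X m \<phi> (Op X n \<theta> x) = Op X n (map (nth \<theta>) \<phi>) x)"

definition smap :: "'a sset \<Rightarrow> 'b sset \<Rightarrow> (nat \<Rightarrow> 'a \<Rightarrow> 'b) \<Rightarrow> bool" where
  "smap X Y F \<longleftrightarrow>
     (\<forall>n. \<forall>x\<in>Simp X n. F n x \<in> Simp Y n) \<and>
     (\<forall>m n. \<forall>\<theta>\<in>simplex_ops m n. \<forall>x\<in>Simp X n. F m (Op X n \<theta> x) = Op Y n \<theta> (F n x))"

definition prod_sset :: "'a sset \<Rightarrow> 'b sset \<Rightarrow> ('a \<times> 'b) sset" where
  "prod_sset X Y = \<lparr>Simp = (\<lambda>n. Simp X n \<times> Simp Y n),
                    Op = (\<lambda>n \<theta>. map_prod (Op X n \<theta>) (Op Y n \<theta>))\<rparr>"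

definition pullback_sset ::
    "'a sset \<Rightarrow> 'b sset \<Rightarrow> (nat \<Rightarrow> 'a \<Rightarrow> 'c) \<Rightarrow> (nat \<Rightarrow> 'b \<Rightarrow> 'c) \<Rightarrow> ('a \<times> 'b) sset" where
  "pullback_sset X Y F G = \<lparr>Simp = (\<lambda>n. {(x, y). x \<in> Simp X n \<and> y \<in> Simp Y n \<and> F n x = G n y}),
                            Op = (\<lambda>n \<theta>. map_prod (Op X n \<theta>) (Op Y n \<theta>))\<rparr>"

definition std_simplex :: "nat \<Rightarrow> nat list sset" where
  "std_simplex n = \<lparr>Simp = (\<lambda>m. simplex_ops m n), Op = (\<lambda>_ \<theta> x. map (nth x) \<theta>)\<rparr>"

definition boundary :: "nat \<Rightarrow> nat list sset" where
  "boundary n = \<lparr>Simp = (\<lambda>m. {x \<in> simplex_ops m n. set x \<noteq> {..n}}), Op = (\<lambda>_ \<theta> x. map (nth x) \<theta>)\<rparr>"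

definition horn :: "nat \<Rightarrow> nat \<Rightarrow> nat list sset" where
  "horn n k = \<lparr>Simp = (\<lambda>m. {x \<in> simplex_ops m n. insert k (set x) \<noteq> {..n}}),
               Op = (\<lambda>_ \<theta> x. map (nth x) \<theta>)\<rparr>"

text \<open>The nerve of the groupoid with two objects 0, 1 and exactly one morphism between any two.\<close>

definition walking_iso :: "nat list sset" where
  "walking_iso = \<lparr>Simp = (\<lambda>m. {x. length x = Suc m \<and> set x \<subseteq> {0, 1}}),
                  Op = (\<lambda>_ \<theta> x. map (nth x) \<theta>)\<rparr>"


section \<open>Infinity-categories\<close>

definition quasicategory :: "'a sset \<Rightarrow> bool" where
  "quasicategory C \<longleftrightarrow> simplicial_set C \<and>
     (\<forall>n k f. 0 < k \<and> k < n \<and> smap (horn n k) C f \<longrightarrow>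
        (\<exists>\<sigma>\<in>Simp C n. \<forall>m. \<forall>\<theta>\<in>Simp (horn n k) m. Op C n \<theta> \<sigma> = f m \<theta>))"

text \<open>Contractible Kan complexes (including \<open>n = 0\<close>, which says that \<open>X\<close> is nonempty).\<close>

definition contractible_sset :: "'a sset \<Rightarrow> bool" where
  "contractible_sset X \<longleftrightarrow> simplicial_set X \<and>
     (\<forall>n f. smap (boundary n) X f \<longrightarrow>
        (\<exists>\<sigma>\<in>Simp X n. \<forall>m. \<forall>\<theta>\<in>Simp (boundary n) m. Op X n \<theta> \<sigma> = f m \<theta>))"

text \<open>
  Natural equivalence of functors between quasicategories: a map from the walking isomorphism to
  the functor quasicategory, transposed to a homotopy.
\<close>

definition naturally_equivalent ::
    "'a sset \<Rightarrow> 'b sset \<Rightarrow> (nat \<Rightarrow> 'a \<Rightarrow> 'b) \<Rightarrow> (nat \<Rightarrow> 'a \<Rightarrow> 'b) \<Rightarrow> bool" where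
  "naturally_equivalent X Y F G \<longleftrightarrow>
     (\<exists>H. smap (prod_sset X walking_iso) Y H \<and>
        (\<forall>n. \<forall>x\<in>Simp X n. H n (x, replicate (Suc n) 0) = F n x \<and>
                          H n (x, replicate (Suc n) 1) = G n x))"

definition inverse_equivalences ::
    "'a sset \<Rightarrow> 'b sset \<Rightarrow> (nat \<Rightarrow> 'a \<Rightarrow> 'b) \<Rightarrow> (nat \<Rightarrow> 'b \<Rightarrow> 'a) \<Rightarrow> bool" where
  "inverse_equivalences X Y F G \<longleftrightarrow> smap X Y F \<and> smap Y X G \<and>
     naturally_equivalent X X (\<lambda>n x. x) (\<lambda>n x. G n (F n x)) \<and>
     naturally_equivalent Y Y (\<lambda>n y. F n (G n y)) (\<lambda>n y. y)"

definition equivalence_of_qcats :: "'a sset \<Rightarrow> 'b sset \<Rightarrow> (nat \<Rightarrow> 'a \<Rightarrow> 'b) \<Rightarrow> bool" where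
  "equivalence_of_qcats X Y F \<longleftrightarrow>
     quasicategory X \<and> quasicategory Y \<and> (\<exists>G. inverse_equivalences X Y F G)"

text \<open>
  The slices \<open>C\<^sub>x\<^sub>/\<close> and \<open>C\<^sub>/\<^sub>y\<close>: an \<open>n\<close>-simplex is an \<open>(n + 1)\<close>-simplex of \<open>C\<close> whose
  first (respectively last) vertex is the given one.
\<close>

definition slice_under :: "'a sset \<Rightarrow> 'a \<Rightarrow> 'a sset" where
  "slice_under C x = \<lparr>Simp = (\<lambda>n. {\<sigma> \<in> Simp C (Suc n). Op C (Suc n) [0] \<sigma> = x}),
                      Op = (\<lambda>n \<theta>. Op C (Suc n) (0 # map Suc \<theta>))\<rparr>"

definition slice_over :: "'a sset \<Rightarrow> 'a \<Rightarrow> 'a sset" where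
  "slice_over C y = \<lparr>Simp = (\<lambda>n. {\<sigma> \<in> Simp C (Suc n). Op C (Suc n) [Suc n] \<sigma> = y}),
                     Op = (\<lambda>n \<theta>. Op C (Suc n) (\<theta> @ [Suc n]))\<rparr>"

text \<open>
  The mapping space from \<open>x\<close> to \<open>y\<close> in its right-pinched model: the fibre over \<open>x\<close> of the
  projection \<open>C\<^sub>/\<^sub>y \<rightarrow> C\<close>.
\<close>

definition mapping_space :: "'a sset \<Rightarrow> 'a \<Rightarrow> 'a \<Rightarrow> 'a sset" where
  "mapping_space C x y =
     (slice_over C y)\<lparr>Simp := (\<lambda>n. {\<sigma> \<in> Simp (slice_over C y) n.
        Op C (Suc n) [0..<Suc n] \<sigma> = Op C 0 (replicate (Suc n) 0) x})\<rparr>"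

text \<open>
  For an edge \<open>e : A \<rightarrow> Y\<close>, regarded as an object of \<open>C\<^sub>A\<^sub>/\<close>, this is
  \<open>C\<^sub>A\<^sub>/\<^sub>/\<^sub>Y = (C\<^sub>A\<^sub>/)\<^sub>/\<^sub>e\<close>; its objects are the 2-simplices with long edge \<open>e\<close>.
\<close>

definition slice_between :: "'a sset \<Rightarrow> 'a \<Rightarrow> 'a sset" where
  "slice_between C e = slice_over (slice_under C (Op C 1 [0] e)) e"

text \<open>
  A commutative square with left edge \<open>f : A \<rightarrow> B\<close> and right edge \<open>g : X \<rightarrow> Y\<close> consists of two
  2-simplices \<open>\<sigma> = (A, B, Y)\<close> and \<open>\<tau> = (A, X, Y)\<close> with a common diagonal.  Orthogonality says
  that the space of maps from \<open>B\<close> to \<open>X\<close> in \<open>C\<^sub>A\<^sub>/\<^sub>/\<^sub>Y\<close> is contractible for each such square.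
\<close>

definition orthogonal :: "'a sset \<Rightarrow> 'a \<Rightarrow> 'a \<Rightarrow> bool" where
  "orthogonal C f g \<longleftrightarrow>
     (\<forall>\<sigma>\<in>Simp C 2. \<forall>\<tau>\<in>Simp C 2.
        Op C 2 [0, 1] \<sigma> = f \<and> Op C 2 [1, 2] \<tau> = g \<and> Op C 2 [0, 2] \<sigma> = Op C 2 [0, 2] \<tau> \<longrightarrow>
        contractible_sset (mapping_space (slice_between C (Op C 2 [0, 2] \<sigma>)) \<sigma> \<tau>))"

text \<open>
  \<open>f\<close> is a retract of \<open>g\<close> in the quasicategory of edges of \<open>C\<close>: the map \<open>R\<close> is the transpose of a
  2-simplex \<open>f \<rightarrow> g \<rightarrow> f\<close> of that quasicategory whose long edge is the identity of \<open>f\<close>.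
\<close>

definition retract_of_edge :: "'a sset \<Rightarrow> 'a \<Rightarrow> 'a \<Rightarrow> bool" where
  "retract_of_edge C f g \<longleftrightarrow>
     (\<exists>R. smap (prod_sset (std_simplex 2) (std_simplex 1)) C R \<and>
        R 1 ([1, 1], [0, 1]) = g \<and>
        (\<forall>n. \<forall>s\<in>simplex_ops n 1. \<forall>t\<in>simplex_ops n 1. R n (map (\<lambda>i. 2 * i) s, t) = Op C 1 t f))"

definition retract_closed :: "'a sset \<Rightarrow> 'a set \<Rightarrow> bool" where
  "retract_closed C S \<longleftrightarrow> (\<forall>g\<in>S. \<forall>f\<in>Simp C 1. retract_of_edge C f g \<longrightarrow> f \<in> S)"

definition factorization_system :: "'a sset \<Rightarrow> 'a set \<Rightarrow> 'a set \<Rightarrow> bool" where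
  "factorization_system C L R \<longleftrightarrow>
     L \<subseteq> Simp C 1 \<and> R \<subseteq> Simp C 1 \<and>
     retract_closed C L \<and> retract_closed C R \<and>
     (\<forall>f\<in>L. \<forall>g\<in>R. orthogonal C f g) \<and>
     (\<forall>h\<in>Simp C 1. \<exists>\<sigma>\<in>Simp C 2.
        Op C 2 [0, 1] \<sigma> \<in> L \<and> Op C 2 [1, 2] \<sigma> \<in> R \<and> Op C 2 [0, 2] \<sigma> = h)"


section \<open>Algebraic patterns\<close>

text \<open>
  The elementary objects are a set of objects; they span the full subcategory \<open>el_cat\<close> of the
  wide subcategory \<open>int_cat\<close> below.  As usual for full subcategories of quasicategories, the set
  is not required to be closed under equivalence.
\<close>

record 'a pattern =
  Cat :: "'a sset"
  Inert :: "'a set"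
  Active :: "'a set"
  Elem :: "'a set"

definition algebraic_pattern :: "'a pattern \<Rightarrow> bool" where
  "algebraic_pattern P \<longleftrightarrow>
     quasicategory (Cat P) \<and>
     factorization_system (Cat P) (Inert P) (Active P) \<and>
     Elem P \<subseteq> Simp (Cat P) 0"

definition pattern_morphism :: "'a pattern \<Rightarrow> 'b pattern \<Rightarrow> (nat \<Rightarrow> 'a \<Rightarrow> 'b) \<Rightarrow> bool" where
  "pattern_morphism P Q F \<longleftrightarrow>
     smap (Cat P) (Cat Q) F \<and>
     F 1 ` Inert P \<subseteq> Inert Q \<and> F 1 ` Active P \<subseteq> Active Q \<and> F 0 ` Elem P \<subseteq> Elem Q"

definition pattern_equivalence :: "'a pattern \<Rightarrow> 'b pattern \<Rightarrow> (nat \<Rightarrow> 'a \<Rightarrow> 'b) \<Rightarrow> bool" where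
  "pattern_equivalence P Q F \<longleftrightarrow>
     algebraic_pattern P \<and> algebraic_pattern Q \<and> pattern_morphism P Q F \<and>
     (\<exists>G. pattern_morphism Q P G \<and> inverse_equivalences (Cat P) (Cat Q) F G)"

definition prod_pattern :: "'a pattern \<Rightarrow> 'b pattern \<Rightarrow> ('a \<times> 'b) pattern" where
  "prod_pattern P Q = \<lparr>Cat = prod_sset (Cat P) (Cat Q), Inert = Inert P \<times> Inert Q,
                       Active = Active P \<times> Active Q, Elem = Elem P \<times> Elem Q\<rparr>"

definition int_cat :: "'a pattern \<Rightarrow> 'a sset" where
  "int_cat P = (Cat P)\<lparr>Simp := (\<lambda>n. {x \<in> Simp (Cat P) n.
     \<forall>i j. i \<le> j \<and> j \<le> n \<longrightarrow> Op (Cat P) n [i, j] x \<in> Inert P})\<rparr>"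

definition el_cat :: "'a pattern \<Rightarrow> 'a sset" where
  "el_cat P = (int_cat P)\<lparr>Simp := (\<lambda>n. {x \<in> Simp (int_cat P) n.
     \<forall>i\<le>n. Op (Cat P) n [i] x \<in> Elem P})\<rparr>"

text \<open>
  The fibre product of \<open>el_cat P\<close> with \<open>slice_under (int_cat P) x\<close> over \<open>int_cat P\<close>; the
  projection from the slice omits the vertex 0.
\<close>

definition el_under :: "'a pattern \<Rightarrow> 'a \<Rightarrow> ('a \<times> 'a) sset" where
  "el_under P x = pullback_sset (el_cat P) (slice_under (int_cat P) x)
     (\<lambda>n \<sigma>. \<sigma>) (\<lambda>n. Op (Cat P) (Suc n) [1..<Suc (Suc n)])"

definition el_under_map :: "(nat \<Rightarrow> 'a \<Rightarrow> 'b) \<Rightarrow> nat \<Rightarrow> 'a \<times> 'a \<Rightarrow> 'b \<times> 'b" where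
  "el_under_map F n = map_prod (F n) (F (Suc n))"


section \<open>Finite pointed sets\<close>

record ('o, 'm) category =
  Ob :: "'o set"
  Hom :: "'o \<Rightarrow> 'o \<Rightarrow> 'm set"
  Idn :: "'o \<Rightarrow> 'm"
  Cmp :: "'o \<Rightarrow> 'o \<Rightarrow> 'o \<Rightarrow> 'm \<Rightarrow> 'm \<Rightarrow> 'm"

text \<open>
  An \<open>n\<close>-simplex of the nerve is a functor from the ordinal \<open>[n]\<close>, given by its values on objects
  and on the morphisms \<open>i \<le> j\<close>.
\<close>

type_synonym ('o, 'm) chain = "(nat \<Rightarrow> 'o) \<times> (nat \<times> nat \<Rightarrow> 'm)"

definition nerve :: "('o, 'm) category \<Rightarrow> ('o, 'm) chain sset" where
  "nerve C =
     \<lparr>Simp = (\<lambda>n. {(ob, ar).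
        ob \<in> {..n} \<rightarrow>\<^sub>E Ob C \<and>
        ar \<in> (\<Pi>\<^sub>E (i, j) \<in> {(i, j). i \<le> j \<and> j \<le> n}. Hom C (ob i) (ob j)) \<and>
        (\<forall>i\<le>n. ar (i, i) = Idn C (ob i)) \<and>
        (\<forall>i j k. i \<le> j \<and> j \<le> k \<and> k \<le> n \<longrightarrow>
           ar (i, k) = Cmp C (ob i) (ob j) (ob k) (ar (j, k)) (ar (i, j)))}),
      Op = (\<lambda>_ \<theta> (ob, ar).
        (\<lambda>i\<in>{..<length \<theta>}. ob (\<theta> ! i),
         \<lambda>(i, j)\<in>{(i, j). i \<le> j \<and> j < length \<theta>}. ar (\<theta> ! i, \<theta> ! j)))\<rparr>"

text \<open>The object \<open>n\<close> stands for the set \<open>{0, \<dots>, n}\<close> pointed at 0.\<close>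

definition fin_ptd :: "(nat, nat \<Rightarrow> nat) category" where
  "fin_ptd = \<lparr>Ob = UNIV,
              Hom = (\<lambda>m n. {f \<in> {..m} \<rightarrow>\<^sub>E {..n}. f 0 = 0}),
              Idn = (\<lambda>n. \<lambda>i\<in>{..n}. i),
              Cmp = (\<lambda>l m n g f. compose {..l} g f)\<rparr>"

type_synonym fin_chain = "(nat, nat \<Rightarrow> nat) chain"

definition inert_map :: "nat \<Rightarrow> nat \<Rightarrow> (nat \<Rightarrow> nat) \<Rightarrow> bool" where
  "inert_map m n f \<longleftrightarrow> bij_betw f {i \<in> {..m}. f i \<noteq> 0} {1..n}"

definition active_map :: "nat \<Rightarrow> nat \<Rightarrow> (nat \<Rightarrow> nat) \<Rightarrow> bool" where
  "active_map m n f \<longleftrightarrow> {i \<in> {..m}. f i = 0} = {0}"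

definition fin_pattern :: "nat set \<Rightarrow> fin_chain pattern" where
  "fin_pattern E =
     \<lparr>Cat = nerve fin_ptd,
      Inert = {(ob, ar) \<in> Simp (nerve fin_ptd) 1. inert_map (ob 0) (ob 1) (ar (0, 1))},
      Active = {(ob, ar) \<in> Simp (nerve fin_ptd) 1. active_map (ob 0) (ob 1) (ar (0, 1))},
      Elem = {(ob, ar) \<in> Simp (nerve fin_ptd) 0. ob 0 \<in> E}\<rparr>"

definition fin_flat :: "fin_chain pattern" where
  "fin_flat = fin_pattern {1}"

definition fin_natural :: "fin_chain pattern" where
  "fin_natural = fin_pattern {0, 1}"

text \<open>
  The smash product of \<open>\<langle>m\<rangle>\<close> and \<open>\<langle>n\<rangle>\<close> is identified with \<open>\<langle>m * n\<rangle>\<close> by enumerating the pairs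
  \<open>(i, j)\<close> with \<open>1 \<le> i \<le> m\<close>, \<open>1 \<le> j \<le> n\<close> lexicographically: \<open>smash_pair n\<close> is the quotient map, and
  \<open>smash_fst n\<close>, \<open>smash_snd n\<close> choose a representative.
\<close>

definition smash_pair :: "nat \<Rightarrow> nat \<Rightarrow> nat \<Rightarrow> nat" where
  "smash_pair n i j = (if i = 0 \<or> j = 0 then 0 else (i - 1) * n + j)"

definition smash_fst :: "nat \<Rightarrow> nat \<Rightarrow> nat" where
  "smash_fst n k = (if k = 0 then 0 else (k - 1) div n + 1)"

definition smash_snd :: "nat \<Rightarrow> nat \<Rightarrow> nat" where
  "smash_snd n k = (if k = 0 then 0 else (k - 1) mod n + 1)"

text \<open>The smash product of \<open>f : \<langle>m\<rangle> \<rightarrow> \<langle>m'\<rangle>\<close> and \<open>g : \<langle>n\<rangle> \<rightarrow> \<langle>n'\<rangle>\<close>.\<close>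

definition smash_map ::
    "nat \<Rightarrow> nat \<Rightarrow> nat \<Rightarrow> (nat \<Rightarrow> nat) \<Rightarrow> (nat \<Rightarrow> nat) \<Rightarrow> nat \<Rightarrow> nat" where
  "smash_map m n n' f g = (\<lambda>k\<in>{..m * n}. smash_pair n' (f (smash_fst n k)) (g (smash_snd n k)))"

lemma smash_pair_inverse:
  assumes "1 \<le> i" "1 \<le> j" "j \<le> n"
  shows "smash_fst n (smash_pair n i j) = i" "smash_snd n (smash_pair n i j) = j"
proof -
  obtain a b where ab: "i = Suc a" "j = Suc b" "b < n"
    using assms by (metis Suc_le_D Suc_le_lessD One_nat_def)
  then show "smash_fst n (smash_pair n i j) = i" "smash_snd n (smash_pair n i j) = j"
    by (simp_all add: smash_fst_def smash_snd_def smash_pair_def)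
qed

lemma smash_rep:
  assumes "1 \<le> k" "k \<le> m * n"
  shows "smash_fst n k \<in> {1..m}" "smash_snd n k \<in> {1..n}"
    and "smash_pair n (smash_fst n k) (smash_snd n k) = k"
proof -
  obtain a where a: "k = Suc a" "a < m * n" using assms by (cases k) auto
  then have "0 < n" by (cases n) auto
  then show "smash_fst n k \<in> {1..m}" "smash_snd n k \<in> {1..n}"
    using a by (simp_all add: smash_fst_def smash_snd_def Suc_le_eq less_mult_imp_div_less)
  show "smash_pair n (smash_fst n k) (smash_snd n k) = k"
    using a by (simp add: smash_fst_def smash_snd_def smash_pair_def)
qed

text \<open>
  So \<open>\<langle>m * n\<rangle>\<close> is the product of \<open>\<langle>m\<rangle>\<close> and \<open>\<langle>n\<rangle>\<close> with the two axes collapsed to the base point,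
  and \<open>smash_map\<close> is the map induced on the quotients.
\<close>

lemma smash_pair_image: "case_prod (smash_pair n) ` ({..m} \<times> {..n}) = {..m * n}"
proof (intro equalityI subsetI)
  fix k assume "k \<in> case_prod (smash_pair n) ` ({..m} \<times> {..n})"
  then obtain i j where ij: "i \<le> m" "j \<le> n" "k = smash_pair n i j" by auto
  show "k \<in> {..m * n}"
  proof (cases "i = 0 \<or> j = 0")
    case False
    then obtain a where a: "i = Suc a" by (cases i) auto
    then have "k \<le> a * n + n" using ij False by (simp add: smash_pair_def)
    also have "\<dots> = Suc a * n" by simp
    also have "\<dots> \<le> m * n" using a ij by (intro mult_right_mono) auto
    finally show ?thesis by simp
  qed (use ij in \<open>auto simp: smash_pair_def\<close>)
next
  fix k assume k: "k \<in> {..m * n}"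
  show "k \<in> case_prod (smash_pair n) ` ({..m} \<times> {..n})"
  proof (cases "k = 0")
    case True
    then show ?thesis by (intro image_eqI[of _ _ "(0, 0)"]) (auto simp: smash_pair_def)
  next
    case False
    then show ?thesis using k smash_rep[of k m n]
      by (intro image_eqI[of _ _ "(smash_fst n k, smash_snd n k)"]) auto
  qed
qed

lemma smash_pair_eq_iff:
  assumes "j \<le> n" "j' \<le> n"
  shows "smash_pair n i j = smash_pair n i' j' \<longleftrightarrow>
    (i = i' \<and> j = j') \<or> ((i = 0 \<or> j = 0) \<and> (i' = 0 \<or> j' = 0))"
proof (cases "(i = 0 \<or> j = 0) \<or> (i' = 0 \<or> j' = 0)")
  case True
  then show ?thesis by (auto simp: smash_pair_def)
next
  case False
  then show ?thesis
    using assms smash_pair_inverse[of i j n] smash_pair_inverse[of i' j' n] by fastforce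
qed

lemma smash_map_pair:
  assumes "i \<le> m" "j \<le> n" "f 0 = 0" "g 0 = 0"
  shows "smash_map m n n' f g (smash_pair n i j) = smash_pair n' (f i) (g j)"
proof -
  have "smash_pair n i j \<in> {..m * n}"
    using assms smash_pair_image[of n m] by force
  then show ?thesis
    using assms smash_pair_inverse[of i j n]
    by (cases "i = 0 \<or> j = 0")
       (auto simp: smash_map_def smash_pair_def[of n' 0] smash_pair_def[of n 0]
          smash_pair_def[of n _ 0] smash_pair_def[of n' _ 0] smash_fst_def[of n 0] smash_snd_def[of n 0])
qed

definition smash_nerve :: "nat \<Rightarrow> fin_chain \<times> fin_chain \<Rightarrow> fin_chain" where
  "smash_nerve n = (\<lambda>((ob, ar), (ob', ar')).
     (\<lambda>i\<in>{..n}. ob i * ob' i,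
      \<lambda>(i, j)\<in>{(i, j). i \<le> j \<and> j \<le> n}.
        smash_map (ob i) (ob' i) (ob' j) (ar (i, j)) (ar' (i, j))))"

definition smash_structure ::
    "(nat \<Rightarrow> 'a \<Rightarrow> fin_chain) \<Rightarrow> (nat \<Rightarrow> 'b \<Rightarrow> fin_chain) \<Rightarrow> nat \<Rightarrow> 'a \<times> 'b \<Rightarrow> fin_chain" where
  "smash_structure F G n = (\<lambda>(x, y). smash_nerve n (F n x, G n y))"


section \<open>Cartesian and enrichable patterns\<close>

definition cartesian_pattern :: "'a pattern \<Rightarrow> (nat \<Rightarrow> 'a \<Rightarrow> fin_chain) \<Rightarrow> bool" where
  "cartesian_pattern P F \<longleftrightarrow>
     algebraic_pattern P \<and> pattern_morphism P fin_flat F \<and>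
     (\<forall>x\<in>Simp (Cat P) 0.
        equivalence_of_qcats (el_under P x) (el_under fin_flat (F 0 x)) (el_under_map F))"

definition flat :: "'a pattern \<Rightarrow> (nat \<Rightarrow> 'a \<Rightarrow> fin_chain) \<Rightarrow> 'a pattern" where
  "flat P F = P\<lparr>Elem := {x \<in> Elem P. F 0 x \<in> Elem fin_flat}\<rparr>"

definition enrichable_pattern :: "'a pattern \<Rightarrow> (nat \<Rightarrow> 'a \<Rightarrow> fin_chain) \<Rightarrow> bool" where
  "enrichable_pattern P F \<longleftrightarrow>
     algebraic_pattern P \<and> pattern_morphism P fin_natural F \<and> cartesian_pattern (flat P F) F"

end

theory Submission
  imports Defs
begin

text \<open>
  The point is that \<open>el_under fin_flat \<langle>m\<rangle>\<close> is discrete.  Its objects are the inert maps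
  \<open>\<langle>m\<rangle> \<rightarrow> \<langle>1\<rangle>\<close>, and such a map is determined by the one element \<open>k \<in> {1, \<dots>, m}\<close> that it does not
  send to the base point; the only inert endomorphism of \<open>\<langle>1\<rangle>\<close> is the identity.  So in every
  dimension the simplices are indexed by \<open>{1, \<dots>, m}\<close> (\<open>bij_betw_star_under\<close>).  The smash product
  of the maps picking out \<open>i\<close> and \<open>j\<close> picks out the pair \<open>(i, j)\<close>, and the nonzero elements of
  \<open>\<langle>m * n\<rangle>\<close> are exactly the pairs of nonzero elements.  Hence smashing is an isomorphism, not
  merely an equivalence, from \<open>el_under fin_flat \<langle>m\<rangle> \<times> el_under fin_flat \<langle>n\<rangle>\<close> to
  \<open>el_under fin_flat \<langle>m * n\<rangle>\<close> (\<open>sset_iso_smash_under\<close>).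

  On the other side, \<open>el_under\<close> of a product of patterns is the product of the two \<open>el_under\<close>
  up to reordering of coordinates (\<open>sset_iso_interchange\<close>).  Therefore the comparison map of the
  product pattern is, up to isomorphisms at both ends, the product of the comparison maps of the
  two factors, which are equivalences by hypothesis.  Since equivalences are closed under products
  and under conjugation by isomorphisms, the product of cartesian patterns is cartesian
  (\<open>cartesian_pattern_prod\<close>).

  The remaining structure is formal.  Slices and mapping spaces commute with products of simplicial
  sets on the nose, so orthogonality, factorizations and closure under retracts are checked in each
  coordinate.  Smash products of inert maps are inert and smash products of active maps are active.
  Finally, for \<open>m, n \<in> {0, 1}\<close> the number \<open>m * n\<close> again lies in \<open>{0, 1}\<close>, and \<open>m * n = 1\<close> iff
  \<open>m = n = 1\<close>; so the smash product preserves elementary objects, and the patterns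
  \<open>(P \<times> Q)\<^sup>\<flat>\<close> and \<open>P\<^sup>\<flat> \<times> Q\<^sup>\<flat>\<close> are equal (\<open>flat_prod\<close>).
\<close>

section \<open>Products of simplicial sets\<close>

lemma simplex_opsI [intro]:
  "i \<le> n \<Longrightarrow> [i] \<in> simplex_ops 0 n"
  "i \<le> j \<Longrightarrow> j \<le> n \<Longrightarrow> [i, j] \<in> simplex_ops 1 n"
  "[1..<Suc (Suc n)] \<in> simplex_ops n (Suc n)"
  by (auto simp: simplex_ops_def simp del: upt_Suc)

lemma Simp_prod_sset [simp]: "Simp (prod_sset X Y) n = Simp X n \<times> Simp Y n"
  and Op_prod_sset [simp]: "Op (prod_sset X Y) n \<theta> = map_prod (Op X n \<theta>) (Op Y n \<theta>)"
  by (simp_all add: prod_sset_def)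

lemma smap_simp: "smap X Y F \<Longrightarrow> x \<in> Simp X n \<Longrightarrow> F n x \<in> Simp Y n"
  and smap_op: "smap X Y F \<Longrightarrow> \<theta> \<in> simplex_ops m n \<Longrightarrow> x \<in> Simp X n \<Longrightarrow>
    F m (Op X n \<theta> x) = Op Y n \<theta> (F n x)"
  by (auto simp: smap_def)

lemma simplicial_set_op:
  "simplicial_set X \<Longrightarrow> \<theta> \<in> simplex_ops m n \<Longrightarrow> x \<in> Simp X n \<Longrightarrow> Op X n \<theta> x \<in> Simp X m"
  by (auto simp: simplicial_set_def)

lemma smap_id: "smap X X (\<lambda>n x. x)"
  by (simp add: smap_def)

lemma smap_comp: "smap X Y F \<Longrightarrow> smap Y Z G \<Longrightarrow> smap X Z (\<lambda>n x. G n (F n x))"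
  by (simp add: smap_def)

lemma smap_map_prod:
  "smap X X' F \<Longrightarrow> smap Y Y' G \<Longrightarrow>
    smap (prod_sset X Y) (prod_sset X' Y') (\<lambda>n. map_prod (F n) (G n))"
  by (auto simp: smap_def)

lemma smap_into_prod:
  assumes "smap X (prod_sset Y Z) F"
  shows "smap X Y (\<lambda>n x. fst (F n x))" "smap X Z (\<lambda>n x. snd (F n x))"
  using assms unfolding smap_def by (auto simp: mem_Times_iff)

lemma simplicial_set_prod:
  "simplicial_set X \<Longrightarrow> simplicial_set Y \<Longrightarrow> simplicial_set (prod_sset X Y)"
  unfolding simplicial_set_def by (auto simp: mem_Times_iff)

text \<open>
  Inner horn filling and boundary filling are both of the following form, so one argument serves
  for quasicategories and for contractible Kan complexes.
\<close>

definition extends_along :: "nat list sset \<Rightarrow> nat \<Rightarrow> 'a sset \<Rightarrow> bool" where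
  "extends_along K n X \<longleftrightarrow> (\<forall>f. smap K X f \<longrightarrow>
     (\<exists>\<sigma>\<in>Simp X n. \<forall>m. \<forall>\<theta>\<in>Simp K m. Op X n \<theta> \<sigma> = f m \<theta>))"

lemma quasicategory_iff:
  "quasicategory C \<longleftrightarrow> simplicial_set C \<and> (\<forall>n k. 0 < k \<and> k < n \<longrightarrow> extends_along (horn n k) n C)"
  unfolding quasicategory_def extends_along_def by blast

lemma contractible_iff:
  "contractible_sset X \<longleftrightarrow> simplicial_set X \<and> (\<forall>n. extends_along (boundary n) n X)"
  unfolding contractible_sset_def extends_along_def by blast

text \<open>
  A map into a product is a pair of maps, and a pair of extensions is an extension of the pair.
\<close>

lemma extends_along_prod:
  assumes "extends_along K n X" "extends_along K n Y"
  shows "extends_along K n (prod_sset X Y)"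
  unfolding extends_along_def
proof (intro allI impI)
  fix f assume f: "smap K (prod_sset X Y) f"
  obtain \<sigma> where \<sigma>: "\<sigma> \<in> Simp X n" "\<forall>m. \<forall>\<theta>\<in>Simp K m. Op X n \<theta> \<sigma> = fst (f m \<theta>)"
    using assms(1) smap_into_prod(1)[OF f] unfolding extends_along_def by meson
  obtain \<tau> where \<tau>: "\<tau> \<in> Simp Y n" "\<forall>m. \<forall>\<theta>\<in>Simp K m. Op Y n \<theta> \<tau> = snd (f m \<theta>)"
    using assms(2) smap_into_prod(2)[OF f] unfolding extends_along_def by meson
  show "\<exists>\<sigma>\<in>Simp (prod_sset X Y) n. \<forall>m. \<forall>\<theta>\<in>Simp K m. Op (prod_sset X Y) n \<theta> \<sigma> = f m \<theta>"
    using \<sigma> \<tau> by (intro bexI[of _ "(\<sigma>, \<tau>)"]) auto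
qed

lemma quasicategory_prod:
  "quasicategory X \<Longrightarrow> quasicategory Y \<Longrightarrow> quasicategory (prod_sset X Y)"
  by (simp add: quasicategory_iff simplicial_set_prod extends_along_prod)

lemma contractible_prod:
  "contractible_sset X \<Longrightarrow> contractible_sset Y \<Longrightarrow> contractible_sset (prod_sset X Y)"
  by (simp add: contractible_iff simplicial_set_prod extends_along_prod)

text \<open>
  Restriction maps of a product act in each coordinate, so the next constructions, which only cut
  out simplices by conditions on restrictions, commute with products as an equality of simplicial
  sets.  This spares any comparison of mapping spaces up to equivalence.
\<close>

lemma slice_under_prod:
  "slice_under (prod_sset X Y) (x, y) = prod_sset (slice_under X x) (slice_under Y y)"
  by (auto simp: slice_under_def prod_sset_def fun_eq_iff)

lemma slice_over_prod:
  "slice_over (prod_sset X Y) (x, y) = prod_sset (slice_over X x) (slice_over Y y)"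
  by (auto simp: slice_over_def prod_sset_def fun_eq_iff)

lemma mapping_space_prod:
  "mapping_space (prod_sset X Y) (x, x') (y, y') =
    prod_sset (mapping_space X x y) (mapping_space Y x' y')"
  unfolding mapping_space_def slice_over_prod
  by (auto simp: prod_sset_def fun_eq_iff)

lemma slice_between_prod:
  "slice_between (prod_sset X Y) (e, e') = prod_sset (slice_between X e) (slice_between Y e')"
  by (simp add: slice_between_def slice_under_prod slice_over_prod)


section \<open>Products of patterns\<close>

text \<open>
  A square in a product is a pair of squares, and its space of fillers is the product of the two
  spaces of fillers.
\<close>

lemma orthogonal_prod:
  assumes "orthogonal C f g" "orthogonal D f' g'"
  shows "orthogonal (prod_sset C D) (f, f') (g, g')"
  unfolding orthogonal_def
proof (intro ballI impI, elim conjE)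
  fix \<sigma> \<tau> assume *: "\<sigma> \<in> Simp (prod_sset C D) 2" "\<tau> \<in> Simp (prod_sset C D) 2"
    "Op (prod_sset C D) 2 [0, 1] \<sigma> = (f, f')" "Op (prod_sset C D) 2 [1, 2] \<tau> = (g, g')"
    "Op (prod_sset C D) 2 [0, 2] \<sigma> = Op (prod_sset C D) 2 [0, 2] \<tau>"
  obtain s s' t t' where st: "\<sigma> = (s, s')" "\<tau> = (t, t')" by fastforce
  have "contractible_sset (mapping_space (slice_between C (Op C 2 [0, 2] s)) s t)"
    "contractible_sset (mapping_space (slice_between D (Op D 2 [0, 2] s')) s' t')"
    using assms * unfolding orthogonal_def st by auto
  then show "contractible_sset
      (mapping_space (slice_between (prod_sset C D) (Op (prod_sset C D) 2 [0, 2] \<sigma>)) \<sigma> \<tau>)"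
    by (simp add: st slice_between_prod mapping_space_prod contractible_prod)
qed

lemma retract_of_edge_prod:
  assumes "retract_of_edge (prod_sset C D) (f, f') (g, g')"
  shows "retract_of_edge C f g" "retract_of_edge D f' g'"
proof -
  obtain R where R: "smap (prod_sset (std_simplex 2) (std_simplex 1)) (prod_sset C D) R"
      "R 1 ([1, 1], [0, 1]) = (g, g')"
      "\<forall>n. \<forall>s\<in>simplex_ops n 1. \<forall>t\<in>simplex_ops n 1.
        R n (map (\<lambda>i. 2 * i) s, t) = Op (prod_sset C D) 1 t (f, f')"
    using assms unfolding retract_of_edge_def by blast
  show "retract_of_edge C f g" unfolding retract_of_edge_def
    using R by (intro exI[of _ "\<lambda>n x. fst (R n x)"]) (auto intro: smap_into_prod)
  show "retract_of_edge D f' g'" unfolding retract_of_edge_def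
    using R by (intro exI[of _ "\<lambda>n x. snd (R n x)"]) (auto intro: smap_into_prod)
qed

lemma retract_closed_prod:
  assumes "retract_closed C S" "retract_closed D T"
  shows "retract_closed (prod_sset C D) (S \<times> T)"
  using assms unfolding retract_closed_def
  by (auto dest: retract_of_edge_prod simp del: One_nat_def)

lemma factorization_system_prod:
  assumes "factorization_system C L R" "factorization_system D L' R'"
  shows "factorization_system (prod_sset C D) (L \<times> L') (R \<times> R')"
proof -
  have "\<exists>\<sigma>\<in>Simp (prod_sset C D) 2. Op (prod_sset C D) 2 [0, 1] \<sigma> \<in> L \<times> L' \<and>
      Op (prod_sset C D) 2 [1, 2] \<sigma> \<in> R \<times> R' \<and> Op (prod_sset C D) 2 [0, 2] \<sigma> = (h, h')"
    if h: "h \<in> Simp C 1" "h' \<in> Simp D 1" for h h'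
  proof -
    obtain \<sigma> where \<sigma>: "\<sigma> \<in> Simp C 2" "Op C 2 [0, 1] \<sigma> \<in> L" "Op C 2 [1, 2] \<sigma> \<in> R"
        "Op C 2 [0, 2] \<sigma> = h"
      using assms(1) h(1) unfolding factorization_system_def by blast
    obtain \<tau> where \<tau>: "\<tau> \<in> Simp D 2" "Op D 2 [0, 1] \<tau> \<in> L'" "Op D 2 [1, 2] \<tau> \<in> R'"
        "Op D 2 [0, 2] \<tau> = h'"
      using assms(2) h(2) unfolding factorization_system_def by blast
    show ?thesis using \<sigma> \<tau> by (intro bexI[of _ "(\<sigma>, \<tau>)"]) auto
  qed
  then have "\<forall>h\<in>Simp (prod_sset C D) 1. \<exists>\<sigma>\<in>Simp (prod_sset C D) 2.
      Op (prod_sset C D) 2 [0, 1] \<sigma> \<in> L \<times> L' \<and> Op (prod_sset C D) 2 [1, 2] \<sigma> \<in> R \<times> R' \<and>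
      Op (prod_sset C D) 2 [0, 2] \<sigma> = h"
    unfolding Simp_prod_sset by blast
  moreover have "\<forall>f\<in>L \<times> L'. \<forall>g\<in>R \<times> R'. orthogonal (prod_sset C D) f g"
    using assms unfolding factorization_system_def by (blast intro: orthogonal_prod)
  moreover have "L \<times> L' \<subseteq> Simp (prod_sset C D) 1" "R \<times> R' \<subseteq> Simp (prod_sset C D) 1"
    using assms unfolding factorization_system_def Simp_prod_sset by blast+
  ultimately show ?thesis
    using assms unfolding factorization_system_def by (blast intro: retract_closed_prod)
qed

lemma prod_pattern_sel [simp]:
  "Cat (prod_pattern P Q) = prod_sset (Cat P) (Cat Q)"
  "Inert (prod_pattern P Q) = Inert P \<times> Inert Q"
  "Active (prod_pattern P Q) = Active P \<times> Active Q"
  "Elem (prod_pattern P Q) = Elem P \<times> Elem Q"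
  by (simp_all add: prod_pattern_def)

lemma algebraic_pattern_prod:
  "algebraic_pattern P \<Longrightarrow> algebraic_pattern Q \<Longrightarrow> algebraic_pattern (prod_pattern P Q)"
  unfolding algebraic_pattern_def by (auto simp: quasicategory_prod factorization_system_prod)

lemma pattern_morphism_comp:
  assumes "pattern_morphism P Q F" "pattern_morphism Q R G"
  shows "pattern_morphism P R (\<lambda>n x. G n (F n x))"
  using assms unfolding pattern_morphism_def image_subset_iff by (auto intro: smap_comp)

lemma pattern_morphism_map_prod:
  assumes "pattern_morphism P P' F" "pattern_morphism Q Q' G"
  shows "pattern_morphism (prod_pattern P Q) (prod_pattern P' Q') (\<lambda>n. map_prod (F n) (G n))"
  using assms unfolding pattern_morphism_def by (auto intro: smap_map_prod)


section \<open>Isomorphisms and equivalences of simplicial sets\<close>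

text \<open>
  Bijectivity in each dimension is easier to check than invertibility and amounts to the same:
  \<open>sset_iso_inverse\<close> obtains the inverse map.
\<close>

definition sset_iso :: "'a sset \<Rightarrow> 'b sset \<Rightarrow> (nat \<Rightarrow> 'a \<Rightarrow> 'b) \<Rightarrow> bool" where
  "sset_iso X Y F \<longleftrightarrow> smap X Y F \<and> (\<forall>n. bij_betw (F n) (Simp X n) (Simp Y n))"

lemma sset_iso_inverse:
  assumes "sset_iso X Y F" "simplicial_set X"
  obtains F' where "smap Y X F'" "\<And>n x. x \<in> Simp X n \<Longrightarrow> F' n (F n x) = x"
    "\<And>n y. y \<in> Simp Y n \<Longrightarrow> F n (F' n y) = y"
proof
  let ?F' = "\<lambda>n. inv_into (Simp X n) (F n)"
  have F: "smap X Y F" and bij: "bij_betw (F n) (Simp X n) (Simp Y n)" for n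
    using assms(1) by (auto simp: sset_iso_def)
  show l: "?F' n (F n x) = x" if "x \<in> Simp X n" for n x
    using bij that by (rule bij_betw_inv_into_left)
  show r: "F n (?F' n y) = y" if "y \<in> Simp Y n" for n y
    using bij that by (rule bij_betw_inv_into_right)
  have mem: "?F' n y \<in> Simp X n" if "y \<in> Simp Y n" for n y
    using bij_betw_inv_into[OF bij[of n]] that by (auto dest: bij_betwE)
  have "?F' m (Op Y n \<theta> y) = Op X n \<theta> (?F' n y)"
    if "\<theta> \<in> simplex_ops m n" "y \<in> Simp Y n" for m n \<theta> y
    using l[OF simplicial_set_op[OF assms(2) that(1) mem[OF that(2)]]]
      smap_op[OF F that(1) mem[OF that(2)]] r[OF that(2)] by metis
  then show "smap Y X ?F'" using mem by (auto simp: smap_def)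
qed

text \<open>
  The restriction maps of the target satisfy the simplicial identities because they are the
  conjugates of those of the source.  Thus whatever is isomorphic to a
  quasicategory is itself one, which is how all the simplicial sets occurring in the comparison
  map of a product pattern are recognized as quasicategories.
\<close>

lemma sset_iso_simplicial_set:
  assumes "sset_iso X Y F" "simplicial_set X"
  shows "simplicial_set Y"
proof -
  obtain F' where F': "smap Y X F'" "\<And>n x. x \<in> Simp X n \<Longrightarrow> F' n (F n x) = x"
    "\<And>n y. y \<in> Simp Y n \<Longrightarrow> F n (F' n y) = y"
    using assms by (rule sset_iso_inverse) blast
  have F: "smap X Y F" using assms by (simp add: sset_iso_def)
  \<comment> \<open>Restriction in \<open>Y\<close> is restriction in \<open>X\<close>, conjugated by \<open>F\<close>.\<close>
  have op: "Op Y n \<theta> y = F m (Op X n \<theta> (F' n y))"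
    if "\<theta> \<in> simplex_ops m n" "y \<in> Simp Y n" for m n \<theta> y
    using smap_op[OF F that(1) smap_simp[OF F'(1) that(2)]] F'(3)[OF that(2)] by simp
  have cl: "Op Y n \<theta> y \<in> Simp Y m" if "\<theta> \<in> simplex_ops m n" "y \<in> Simp Y n" for m n \<theta> y
    unfolding op[OF that]
    by (intro smap_simp[OF F] simplicial_set_op[OF assms(2) that(1)] smap_simp[OF F'(1) that(2)])
  have id: "Op Y n [0..<Suc n] y = y" if y: "y \<in> Simp Y n" for n y
  proof -
    have "[0..<Suc n] \<in> simplex_ops n n" by (auto simp: simplex_ops_def simp del: upt_Suc)
    moreover have "Op X n [0..<Suc n] (F' n y) = F' n y"
      using assms(2) smap_simp[OF F'(1) y] unfolding simplicial_set_def by blast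
    ultimately show ?thesis using op[OF _ y] F'(3)[OF y] by metis
  qed
  have comp: "Op Y m \<phi> (Op Y n \<theta> y) = Op Y n (map (nth \<theta>) \<phi>) y"
    if \<phi>: "\<phi> \<in> simplex_ops l m" and \<theta>: "\<theta> \<in> simplex_ops m n" and y: "y \<in> Simp Y n" for l m n \<phi> \<theta> y
  proof -
    have x: "F' n y \<in> Simp X n" by (rule smap_simp[OF F'(1) y])
    have "set (map (nth \<theta>) \<phi>) \<subseteq> set \<theta>"
      using \<phi> \<theta> by (force simp: simplex_ops_def in_set_conv_nth less_Suc_eq_le)
    moreover have "sorted (map (nth \<theta>) \<phi>)"
      using \<phi> \<theta> unfolding simplex_ops_def
      by (auto simp: sorted_iff_nth_mono less_Suc_eq_le)
        (metis atMost_iff le_imp_less_Suc less_Suc_eq_le nth_mem subset_iff)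
    ultimately have c: "map (nth \<theta>) \<phi> \<in> simplex_ops l n"
      using \<phi> \<theta> by (auto simp: simplex_ops_def)
    have "Op Y m \<phi> (Op Y n \<theta> y) = F l (Op X m \<phi> (Op X n \<theta> (F' n y)))"
      using smap_op[OF F \<phi> simplicial_set_op[OF assms(2) \<theta> x]] op[OF \<theta> y] by simp
    also have "Op X m \<phi> (Op X n \<theta> (F' n y)) = Op X n (map (nth \<theta>) \<phi>) (F' n y)"
      using assms(2) \<phi> \<theta> x unfolding simplicial_set_def by blast
    also have "F l \<dots> = Op Y n (map (nth \<theta>) \<phi>) y" using op[OF c y] by simp
    finally show ?thesis .
  qed
  show ?thesis unfolding simplicial_set_def using cl id comp by blast
qed

lemma sset_iso_quasicategory:
  assumes iso: "sset_iso X Y F" and X: "quasicategory X"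
  shows "quasicategory Y"
proof -
  have sX: "simplicial_set X" using X by (simp add: quasicategory_iff)
  have F: "smap X Y F" using iso by (simp add: sset_iso_def)
  obtain F' where F': "smap Y X F'" "\<And>n x. x \<in> Simp X n \<Longrightarrow> F' n (F n x) = x"
    "\<And>n y. y \<in> Simp Y n \<Longrightarrow> F n (F' n y) = y"
    using iso sX by (rule sset_iso_inverse) blast
  have "extends_along (horn n k) n Y" if nk: "0 < k \<and> k < n" for n k
    unfolding extends_along_def
  proof (intro allI impI)
    fix f assume f: "smap (horn n k) Y f"
    obtain \<sigma> where \<sigma>: "\<sigma> \<in> Simp X n" "\<forall>m. \<forall>\<theta>\<in>Simp (horn n k) m. Op X n \<theta> \<sigma> = F' m (f m \<theta>)"
      using X nk smap_comp[OF f F'(1)] unfolding quasicategory_iff extends_along_def by meson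
    have "Op Y n \<theta> (F n \<sigma>) = f m \<theta>" if \<theta>: "\<theta> \<in> Simp (horn n k) m" for m \<theta>
    proof -
      have "\<theta> \<in> simplex_ops m n" using \<theta> by (simp add: horn_def)
      then have "Op Y n \<theta> (F n \<sigma>) = F m (Op X n \<theta> \<sigma>)" using smap_op[OF F _ \<sigma>(1)] by simp
      also have "\<dots> = f m \<theta>" using \<sigma>(2) \<theta> F'(3)[OF smap_simp[OF f \<theta>]] by simp
      finally show ?thesis .
    qed
    then show "\<exists>\<sigma>\<in>Simp Y n. \<forall>m. \<forall>\<theta>\<in>Simp (horn n k) m. Op Y n \<theta> \<sigma> = f m \<theta>"
      using smap_simp[OF F \<sigma>(1)] by blast
  qed
  then show ?thesis using sset_iso_simplicial_set[OF iso sX] by (simp add: quasicategory_iff)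
qed

lemma naturally_equivalent_prod:
  assumes "naturally_equivalent X X' F F'" "naturally_equivalent Y Y' G G'"
  shows "naturally_equivalent (prod_sset X Y) (prod_sset X' Y')
    (\<lambda>n (x, y). (F n x, G n y)) (\<lambda>n (x, y). (F' n x, G' n y))"
proof -
  obtain H where H: "smap (prod_sset X walking_iso) X' H"
    "\<forall>n. \<forall>x\<in>Simp X n. H n (x, replicate (Suc n) 0) = F n x \<and> H n (x, replicate (Suc n) 1) = F' n x"
    using assms(1) unfolding naturally_equivalent_def by blast
  obtain K where K: "smap (prod_sset Y walking_iso) Y' K"
    "\<forall>n. \<forall>x\<in>Simp Y n. K n (x, replicate (Suc n) 0) = G n x \<and> K n (x, replicate (Suc n) 1) = G' n x"
    using assms(2) unfolding naturally_equivalent_def by blast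
  show ?thesis unfolding naturally_equivalent_def
    using H K by (intro exI[of _ "\<lambda>n ((x, y), w). (H n (x, w), K n (y, w))"]) (auto simp: smap_def)
qed

text \<open>
  Whiskering of a homotopy by \<open>S\<close> on the source and \<open>T\<close> on the target.
\<close>

lemma naturally_equivalent_conjugate:
  assumes "naturally_equivalent X X' F F'" "smap A X S" "smap X' B T"
    and "\<And>n a. a \<in> Simp A n \<Longrightarrow> K n a = T n (F n (S n a))"
    and "\<And>n a. a \<in> Simp A n \<Longrightarrow> K' n a = T n (F' n (S n a))"
  shows "naturally_equivalent A B K K'"
proof -
  obtain H where H: "smap (prod_sset X walking_iso) X' H"
    "\<forall>n. \<forall>x\<in>Simp X n. H n (x, replicate (Suc n) 0) = F n x \<and> H n (x, replicate (Suc n) 1) = F' n x"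
    using assms(1) unfolding naturally_equivalent_def by blast
  show ?thesis unfolding naturally_equivalent_def
    using H assms(2-) by (intro exI[of _ "\<lambda>n (a, w). T n (H n (S n a, w))"]) (auto simp: smap_def)
qed

lemma naturally_equivalent_refl: "smap X Y F \<Longrightarrow> naturally_equivalent X Y F F"
  unfolding naturally_equivalent_def by (intro exI[of _ "\<lambda>n (x, w). F n x"]) (auto simp: smap_def)

lemma equivalence_of_qcats_prod:
  assumes "equivalence_of_qcats X X' F" "equivalence_of_qcats Y Y' G"
  shows "equivalence_of_qcats (prod_sset X Y) (prod_sset X' Y') (\<lambda>n. map_prod (F n) (G n))"
proof -
  obtain F' where F': "inverse_equivalences X X' F F'"
    using assms unfolding equivalence_of_qcats_def by blast
  obtain G' where G': "inverse_equivalences Y Y' G G'"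
    using assms unfolding equivalence_of_qcats_def by blast
  have "inverse_equivalences (prod_sset X Y) (prod_sset X' Y')
      (\<lambda>n. map_prod (F n) (G n)) (\<lambda>n. map_prod (F' n) (G' n))"
    using F' G' unfolding inverse_equivalences_def
    by (auto intro!: smap_map_prod naturally_equivalent_prod[THEN naturally_equivalent_conjugate, OF _ _ smap_id smap_id])
  then show ?thesis
    using assms unfolding equivalence_of_qcats_def by (auto intro: quasicategory_prod)
qed

text \<open>
  A map \<open>K\<close> that is carried to an equivalence by isomorphisms of source and target is an
  equivalence: an inverse of \<open>F\<close> and the two homotopies are transported along the isomorphisms.
  As \<open>S\<close> and \<open>T\<close> are strictly invertible, each homotopy is carried to one between the right maps.
\<close>

lemma equivalence_of_qcats_conjugate:
  assumes F: "equivalence_of_qcats X X' F" and iso: "sset_iso X A S" "sset_iso X' B T"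
    and K: "smap A B K" "\<And>n x. x \<in> Simp X n \<Longrightarrow> K n (S n x) = T n (F n x)"
  shows "equivalence_of_qcats A B K"
proof -
  have q: "quasicategory X" "quasicategory X'"
    using F by (auto simp: equivalence_of_qcats_def)
  obtain G where sF: "smap X X' F" and sG: "smap X' X G"
    and GF: "naturally_equivalent X X (\<lambda>n x. x) (\<lambda>n x. G n (F n x))"
    and FG: "naturally_equivalent X' X' (\<lambda>n y. F n (G n y)) (\<lambda>n y. y)"
    using F by (auto simp: equivalence_of_qcats_def inverse_equivalences_def)
  have S: "smap X A S" and T: "smap X' B T" using iso by (auto simp: sset_iso_def)
  obtain S' where S': "smap A X S'" "\<And>n x. x \<in> Simp X n \<Longrightarrow> S' n (S n x) = x"
    "\<And>n y. y \<in> Simp A n \<Longrightarrow> S n (S' n y) = y"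
    using iso(1) q(1) by (auto simp: quasicategory_iff elim: sset_iso_inverse)
  obtain T' where T': "smap B X' T'" "\<And>n x. x \<in> Simp X' n \<Longrightarrow> T' n (T n x) = x"
    "\<And>n y. y \<in> Simp B n \<Longrightarrow> T n (T' n y) = y"
    using iso(2) q(2) by (auto simp: quasicategory_iff elim: sset_iso_inverse)
  have K': "K n a = T n (F n (S' n a))" if "a \<in> Simp A n" for n a
    using K(2)[OF smap_simp[OF S'(1) that]] S'(3)[OF that] by simp
  have "inverse_equivalences A B K (\<lambda>n b. S n (G n (T' n b)))"
    unfolding inverse_equivalences_def
  proof (intro conjI)
    show "smap B A (\<lambda>n b. S n (G n (T' n b)))" by (intro smap_comp[OF smap_comp[OF T'(1) sG] S])
    show "naturally_equivalent A A (\<lambda>n x. x) (\<lambda>n x. S n (G n (T' n (K n x))))"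
      by (rule naturally_equivalent_conjugate[OF GF S'(1) S])
         (simp_all add: K' S' T' smap_simp[OF sF] smap_simp[OF S'(1)])
    show "naturally_equivalent B B (\<lambda>n y. K n (S n (G n (T' n y)))) (\<lambda>n y. y)"
      by (rule naturally_equivalent_conjugate[OF FG T'(1) T])
         (simp_all add: K(2) T' smap_simp[OF sG] smap_simp[OF T'(1)])
  qed (rule K(1))
  then show ?thesis
    unfolding equivalence_of_qcats_def
    using sset_iso_quasicategory[OF iso(1) q(1)] sset_iso_quasicategory[OF iso(2) q(2)] by blast
qed


section \<open>Elementary objects under an object\<close>

lemma Simp_int_cat: "x \<in> Simp (int_cat P) n \<longleftrightarrow> x \<in> Simp (Cat P) n \<and>
    (\<forall>i j. i \<le> j \<and> j \<le> n \<longrightarrow> Op (Cat P) n [i, j] x \<in> Inert P)"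
  and Op_int_cat [simp]: "Op (int_cat P) = Op (Cat P)"
  by (auto simp: int_cat_def)

lemma Simp_el_cat: "x \<in> Simp (el_cat P) n \<longleftrightarrow> x \<in> Simp (int_cat P) n \<and>
    (\<forall>i\<le>n. Op (Cat P) n [i] x \<in> Elem P)"
  and Op_el_cat [simp]: "Op (el_cat P) = Op (Cat P)"
  by (auto simp: el_cat_def int_cat_def)

lemma Simp_el_under: "(s, t) \<in> Simp (el_under P x) n \<longleftrightarrow>
    s \<in> Simp (el_cat P) n \<and> t \<in> Simp (int_cat P) (Suc n) \<and>
    Op (Cat P) (Suc n) [0] t = x \<and> s = Op (Cat P) (Suc n) [1..<Suc (Suc n)] t"
  by (auto simp: el_under_def pullback_sset_def slice_under_def)

lemma Op_el_under [simp]: "Op (el_under P x) n \<theta> =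
    map_prod (Op (Cat P) n \<theta>) (Op (Cat P) (Suc n) (0 # map Suc \<theta>))"
  by (simp add: el_under_def pullback_sset_def slice_under_def)

lemma pattern_morphism_int_cat:
  assumes F: "pattern_morphism P Q F" and x: "x \<in> Simp (int_cat P) n"
  shows "F n x \<in> Simp (int_cat Q) n"
proof -
  have s: "smap (Cat P) (Cat Q) F" and i: "F 1 ` Inert P \<subseteq> Inert Q"
    using F by (auto simp: pattern_morphism_def)
  have "Op (Cat Q) n [i, j] (F n x) \<in> Inert Q" if "i \<le> j" "j \<le> n" for i j
    using smap_op[OF s simplex_opsI(2)[OF that]] x that i unfolding Simp_int_cat
    by (metis image_subset_iff)
  then show ?thesis using x smap_simp[OF s] by (simp add: Simp_int_cat)
qed

lemma pattern_morphism_el_cat: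
  assumes F: "pattern_morphism P Q F" and x: "x \<in> Simp (el_cat P) n"
  shows "F n x \<in> Simp (el_cat Q) n"
proof -
  have s: "smap (Cat P) (Cat Q) F" and e: "F 0 ` Elem P \<subseteq> Elem Q"
    using F by (auto simp: pattern_morphism_def)
  have "Op (Cat Q) n [i] (F n x) \<in> Elem Q" if "i \<le> n" for i
    using smap_op[OF s simplex_opsI(1)[OF that]] x that e unfolding Simp_el_cat Simp_int_cat
    by (metis image_subset_iff)
  then show ?thesis using x pattern_morphism_int_cat[OF F] by (simp add: Simp_el_cat)
qed

text \<open>
  Functoriality of \<open>el_under\<close>.  A restriction along \<open>\<theta>\<close> in the slice is the restriction along the
  cone \<open>0 # map Suc \<theta>\<close> in the underlying category, so both coordinates are instances of the
  naturality of \<open>F\<close>.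
\<close>

lemma smap_el_under:
  assumes F: "pattern_morphism P Q F"
  shows "smap (el_under P x) (el_under Q (F 0 x)) (el_under_map F)"
proof -
  have s: "smap (Cat P) (Cat Q) F" using F by (simp add: pattern_morphism_def)
  have cone: "0 # map Suc \<theta> \<in> simplex_ops (Suc m) (Suc n)" if "\<theta> \<in> simplex_ops m n" for m n \<theta>
    using that by (auto simp: simplex_ops_def sorted_map sorted_wrt_mono_rel[of _ "(\<le>)"])
  show ?thesis unfolding smap_def
  proof (intro conjI allI ballI)
    fix n z assume z: "z \<in> Simp (el_under P x) n"
    obtain a b where [simp]: "z = (a, b)" by fastforce
    have b: "b \<in> Simp (Cat P) (Suc n)" using z by (simp add: Simp_el_under Simp_int_cat)
    show "el_under_map F n z \<in> Simp (el_under Q (F 0 x)) n"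
      using z smap_op[OF s _ b, of "[0]" 0] smap_op[OF s simplex_opsI(3) b]
        pattern_morphism_el_cat[OF F, of a n] pattern_morphism_int_cat[OF F, of b "Suc n"]
      by (auto simp: Simp_el_under el_under_map_def simplex_opsI simp del: upt_Suc)
  next
    fix m n \<theta> z assume \<theta>: "\<theta> \<in> simplex_ops m n" and z: "z \<in> Simp (el_under P x) n"
    obtain a b where [simp]: "z = (a, b)" by fastforce
    have "a \<in> Simp (Cat P) n" "b \<in> Simp (Cat P) (Suc n)"
      using z unfolding \<open>z = _\<close> Simp_el_under Simp_el_cat Simp_int_cat by blast+
    then show "el_under_map F m (Op (el_under P x) n \<theta> z) =
        Op (el_under Q (F 0 x)) n \<theta> (el_under_map F n z)"
      using smap_op[OF s \<theta>] smap_op[OF s cone[OF \<theta>]] by (simp add: el_under_map_def)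
  qed
qed

definition interchange :: "nat \<Rightarrow> ('a \<times> 'b) \<times> ('c \<times> 'd) \<Rightarrow> ('a \<times> 'c) \<times> ('b \<times> 'd)" where
  "interchange n = (\<lambda>((a, b), (c, d)). ((a, c), (b, d)))"

lemma sset_iso_interchange:
  "sset_iso (prod_sset (el_under P x) (el_under Q y)) (el_under (prod_pattern P Q) (x, y)) interchange"
proof -
  have int: "(a, b) \<in> Simp (int_cat (prod_pattern P Q)) n \<longleftrightarrow>
      a \<in> Simp (int_cat P) n \<and> b \<in> Simp (int_cat Q) n" for a b n
    by (auto simp: Simp_int_cat)
  have el: "(a, b) \<in> Simp (el_cat (prod_pattern P Q)) n \<longleftrightarrow>
      a \<in> Simp (el_cat P) n \<and> b \<in> Simp (el_cat Q) n" for a b n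
    by (auto simp: Simp_el_cat int)
  have un: "((a, c), (b, d)) \<in> Simp (el_under (prod_pattern P Q) (x, y)) n \<longleftrightarrow>
      (a, b) \<in> Simp (el_under P x) n \<and> (c, d) \<in> Simp (el_under Q y) n" for a b c d n
    by (auto simp: Simp_el_under el int simp del: upt_Suc)
  have "bij_betw (interchange n) (Simp (el_under P x) n \<times> Simp (el_under Q y) n)
      (Simp (el_under (prod_pattern P Q) (x, y)) n)" for n
    by (rule bij_betw_byWitness[where f' = "interchange n"]) (auto simp: interchange_def un)
  moreover have "smap (prod_sset (el_under P x) (el_under Q y))
      (el_under (prod_pattern P Q) (x, y)) interchange"
    by (auto simp: smap_def interchange_def un)
  ultimately show ?thesis by (simp add: sset_iso_def)
qed


section \<open>The smash product of finite pointed sets\<close>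

lemma Hom_fin_ptd: "f \<in> Hom fin_ptd m n \<longleftrightarrow> f \<in> extensional {..m} \<and> (\<forall>i\<le>m. f i \<le> n) \<and> f 0 = 0"
  by (auto simp: fin_ptd_def PiE_iff)

lemma nerve_fin_iff: "(ob, ar) \<in> Simp (nerve fin_ptd) n \<longleftrightarrow>
    ob \<in> extensional {..n} \<and> ar \<in> extensional {(i, j). i \<le> j \<and> j \<le> n} \<and>
    (\<forall>i j. i \<le> j \<and> j \<le> n \<longrightarrow> ar (i, j) \<in> Hom fin_ptd (ob i) (ob j)) \<and>
    (\<forall>i\<le>n. ar (i, i) = (\<lambda>k\<in>{..ob i}. k)) \<and>
    (\<forall>i j k. i \<le> j \<and> j \<le> k \<and> k \<le> n \<longrightarrow> ar (i, k) = compose {..ob i} (ar (j, k)) (ar (i, j)))"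
proof -
  have "Idn fin_ptd m = (\<lambda>k\<in>{..m}. k)" "Cmp fin_ptd l m n g f = compose {..l} g f"
    "Ob fin_ptd = UNIV" for l m n g f
    by (simp_all add: fin_ptd_def)
  then show ?thesis by (auto simp: nerve_def PiE_iff)
qed

lemma Op_nerve: "Op (nerve C) n \<theta> (ob, ar) =
    (\<lambda>i\<in>{..<length \<theta>}. ob (\<theta> ! i), \<lambda>(i, j)\<in>{(i, j). i \<le> j \<and> j < length \<theta>}. ar (\<theta> ! i, \<theta> ! j))"
  by (simp add: nerve_def)

text \<open>
  Every element of a smash product is the class of a pair.  With \<open>smash_map_pair\<close> this reduces
  statements about smash products of maps to their values on pairs.
\<close>

lemma smash_cases:
  assumes "k \<le> m * n"
  obtains i j where "i \<le> m" "j \<le> n" "k = smash_pair n i j"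
  using assms smash_pair_image[of n m] by (force simp: set_eq_iff image_iff)

lemma smash_pair_le: "i \<le> m \<Longrightarrow> j \<le> n \<Longrightarrow> smash_pair n i j \<le> m * n"
  using smash_pair_image[of n m] by force

lemma smash_pair_eq_0 [simp]: "smash_pair n i j = 0 \<longleftrightarrow> i = 0 \<or> j = 0"
  and smash_pair_pos [simp]: "0 < smash_pair n i j \<longleftrightarrow> 0 < i \<and> 0 < j"
  by (auto simp: smash_pair_def)

text \<open>
  Away from the base point nothing is collapsed.
\<close>

lemma bij_betw_smash_pair: "bij_betw (case_prod (smash_pair n)) ({1..m} \<times> {1..n}) {1..m * n}"
proof -
  have "k \<in> case_prod (smash_pair n) ` ({1..m} \<times> {1..n})" if "k \<in> {1..m * n}" for k
    using smash_rep[of k m n] that by (intro image_eqI[of _ _ "(smash_fst n k, smash_snd n k)"]) auto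
  then have "case_prod (smash_pair n) ` ({1..m} \<times> {1..n}) = {1..m * n}"
    by (auto simp: Suc_le_eq smash_pair_le)
  then show ?thesis by (auto simp: bij_betw_def inj_on_def smash_pair_eq_iff)
qed

lemma smash_map_ext: "smash_map m n n' f g \<in> extensional {..m * n}"
  by (simp add: smash_map_def)

lemma smash_ext:
  assumes "h \<in> extensional {..m * n}" "h' \<in> extensional {..m * n}"
    and "\<And>i j. i \<le> m \<Longrightarrow> j \<le> n \<Longrightarrow> h (smash_pair n i j) = h' (smash_pair n i j)"
  shows "h = h'"
  using assms by (intro extensionalityI[of _ "{..m * n}"]) (auto elim: smash_cases)

lemma smash_map_Hom:
  assumes "f \<in> Hom fin_ptd m m'" "g \<in> Hom fin_ptd n n'"
  shows "smash_map m n n' f g \<in> Hom fin_ptd (m * n) (m' * n')"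
proof -
  have "smash_map m n n' f g k \<le> m' * n'" if "k \<le> m * n" for k
    using that assms by (elim smash_cases) (simp add: Hom_fin_ptd smash_map_pair smash_pair_le)
  moreover have "smash_map m n n' f g 0 = 0"
    using assms smash_map_pair[of 0 m 0 n f g n'] by (simp add: Hom_fin_ptd smash_pair_def)
  ultimately show ?thesis by (simp add: Hom_fin_ptd smash_map_ext)
qed

lemma smash_map_id: "smash_map m n n (\<lambda>k\<in>{..m}. k) (\<lambda>k\<in>{..n}. k) = (\<lambda>k\<in>{..m * n}. k)"
  by (rule smash_ext) (auto simp: smash_map_ext smash_map_pair smash_pair_le)

lemma smash_map_compose:
  assumes "f \<in> Hom fin_ptd l m" "f' \<in> Hom fin_ptd l' m'"
    and "g \<in> Hom fin_ptd m n" "g' \<in> Hom fin_ptd m' n'"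
  shows "smash_map l l' n' (compose {..l} g f) (compose {..l'} g' f') =
    compose {..l * l'} (smash_map m m' n' g g') (smash_map l l' m' f f')"
  using assms
  by (intro smash_ext) (auto simp: smash_map_ext compose_eq smash_map_pair smash_pair_le Hom_fin_ptd)

lemma smash_map_nonzero:
  assumes "f \<in> Hom fin_ptd m m'" "g \<in> Hom fin_ptd n n'"
  shows "{k \<in> {..m * n}. smash_map m n n' f g k \<noteq> 0} =
    case_prod (smash_pair n) ` ({i \<in> {..m}. f i \<noteq> 0} \<times> {j \<in> {..n}. g j \<noteq> 0})"
proof -
  have "k \<in> case_prod (smash_pair n) ` ({i \<in> {..m}. f i \<noteq> 0} \<times> {j \<in> {..n}. g j \<noteq> 0})"
    if "k \<le> m * n" "smash_map m n n' f g k \<noteq> 0" for k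
    using that assms by (elim smash_cases) (force simp: Hom_fin_ptd smash_map_pair)
  then show ?thesis using assms by (auto simp: Hom_fin_ptd smash_map_pair smash_pair_le)
qed

text \<open>
  The elements not sent to the base point by the smash product of \<open>f\<close> and \<open>g\<close> are the pairs of such
  elements for \<open>f\<close> and for \<open>g\<close>.  On these pairs the smash product acts as \<open>f \<times> g\<close>, a bijection
  onto the pairs of nonzero elements of the targets.
\<close>

lemma inert_smash_map:
  assumes f: "f \<in> Hom fin_ptd m m'" "inert_map m m' f" and g: "g \<in> Hom fin_ptd n n'" "inert_map n n' g"
  shows "inert_map (m * n) (m' * n') (smash_map m n n' f g)"
proof -
  let ?A = "{i \<in> {..m}. f i \<noteq> 0} \<times> {j \<in> {..n}. g j \<noteq> 0}"
  have pos: "f 0 = 0" "g 0 = 0" using f g by (auto simp: Hom_fin_ptd)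
  \<comment> \<open>\<open>smash_pair\<close> identifies only pairs on the axes, and \<open>f\<close> and \<open>g\<close> vanish at 0.\<close>
  have inj: "inj_on (case_prod (smash_pair n)) ?A"
    using pos by (auto simp: inj_on_def smash_pair_eq_iff)
  have "bij_betw (map_prod f g) ?A ({1..m'} \<times> {1..n'})"
    using f(2) g(2) unfolding inert_map_def by (rule bij_betw_map_prod)
  then have "bij_betw (case_prod (smash_pair n') \<circ> map_prod f g) ?A {1..m' * n'}"
    using bij_betw_smash_pair by (rule bij_betw_trans)
  moreover have "(case_prod (smash_pair n') \<circ> map_prod f g) x =
      (smash_map m n n' f g \<circ> case_prod (smash_pair n)) x" if "x \<in> ?A" for x
    using that pos by (auto simp: smash_map_pair)
  ultimately have "bij_betw (smash_map m n n' f g \<circ> case_prod (smash_pair n)) ?A {1..m' * n'}"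
    using bij_betw_cong[of ?A] by blast
  then show ?thesis
    unfolding inert_map_def smash_map_nonzero[OF f(1) g(1)]
    using bij_betw_comp_iff[OF inj_on_imp_bij_betw[OF inj]] by blast
qed

lemma active_smash_map:
  assumes f: "f \<in> Hom fin_ptd m m'" "active_map m m' f" and g: "g \<in> Hom fin_ptd n n'" "active_map n n' g"
  shows "active_map (m * n) (m' * n') (smash_map m n n' f g)"
proof -
  have *: "f i = 0 \<longleftrightarrow> i = 0" if "i \<le> m" for i using f that by (auto simp: active_map_def)
  have **: "g i = 0 \<longleftrightarrow> i = 0" if "i \<le> n" for i using g that by (auto simp: active_map_def)
  have "smash_map m n n' f g k = 0 \<longleftrightarrow> k = 0" if "k \<le> m * n" for k
    using that by (elim smash_cases) (simp add: smash_map_pair * **)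
  then show ?thesis by (auto simp: active_map_def)
qed

lemma smash_nerve_Pair: "smash_nerve n ((ob, ar), (ob', ar')) =
     (\<lambda>i\<in>{..n}. ob i * ob' i,
      \<lambda>(i, j)\<in>{(i, j). i \<le> j \<and> j \<le> n}.
        smash_map (ob i) (ob' i) (ob' j) (ar (i, j)) (ar' (i, j)))"
  by (simp add: smash_nerve_def)

lemma smap_smash_nerve: "smap (prod_sset (nerve fin_ptd) (nerve fin_ptd)) (nerve fin_ptd) smash_nerve"
  unfolding smap_def
proof (intro conjI allI ballI)
  fix n z assume z: "z \<in> Simp (prod_sset (nerve fin_ptd) (nerve fin_ptd)) n"
  obtain ob ar ob' ar' where [simp]: "z = ((ob, ar), (ob', ar'))" by (metis surj_pair)
  have z: "(ob, ar) \<in> Simp (nerve fin_ptd) n" "(ob', ar') \<in> Simp (nerve fin_ptd) n"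
    using z by auto
  have H: "ar (i, j) \<in> Hom fin_ptd (ob i) (ob j)" "ar' (i, j) \<in> Hom fin_ptd (ob' i) (ob' j)"
    if "i \<le> j" "j \<le> n" for i j using z that by (auto simp: nerve_fin_iff)
  have I: "ar (i, i) = (\<lambda>k\<in>{..ob i}. k)" "ar' (i, i) = (\<lambda>k\<in>{..ob' i}. k)" if "i \<le> n" for i
    using z that by (auto simp: nerve_fin_iff)
  have C: "ar (i, k) = compose {..ob i} (ar (j, k)) (ar (i, j))"
    "ar' (i, k) = compose {..ob' i} (ar' (j, k)) (ar' (i, j))" if "i \<le> j" "j \<le> k" "k \<le> n" for i j k
    using z that unfolding nerve_fin_iff by blast+
  have "smash_map (ob i) (ob' i) (ob' k) (ar (i, k)) (ar' (i, k)) =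
      compose {..ob i * ob' i} (smash_map (ob j) (ob' j) (ob' k) (ar (j, k)) (ar' (j, k)))
        (smash_map (ob i) (ob' i) (ob' j) (ar (i, j)) (ar' (i, j)))"
    if "i \<le> j" "j \<le> k" "k \<le> n" for i j k
    unfolding C[OF that] using H that by (intro smash_map_compose) auto
  then show "smash_nerve n z \<in> Simp (nerve fin_ptd) n"
    by (auto simp: smash_nerve_Pair nerve_fin_iff smash_map_Hom H I smash_map_id)
next
  fix m n \<theta> and z :: "fin_chain \<times> fin_chain" assume \<theta>: "\<theta> \<in> simplex_ops m n"
  obtain ob ar ob' ar' where [simp]: "z = ((ob, ar), (ob', ar'))" by (metis surj_pair)
  have "\<theta> ! i \<le> \<theta> ! j" "\<theta> ! j \<le> n" if "i \<le> j" "j \<le> m" for i j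
    using \<theta> that by (auto simp: simplex_ops_def sorted_iff_nth_mono subset_iff)
  moreover have "\<theta> ! j \<le> n" if "j \<le> m" for j
    using \<theta> that by (auto simp: simplex_ops_def subset_iff)
  moreover have "length \<theta> = Suc m" using \<theta> by (simp add: simplex_ops_def)
  ultimately show "smash_nerve m (Op (prod_sset (nerve fin_ptd) (nerve fin_ptd)) n \<theta> z) =
      Op (nerve fin_ptd) n \<theta> (smash_nerve n z)"
    by (auto simp: smash_nerve_Pair Op_nerve fun_eq_iff restrict_def less_Suc_eq_le)
qed

lemma Cat_fin_pattern [simp]: "Cat (fin_pattern E) = nerve fin_ptd"
  and Inert_fin_pattern: "(ob, ar) \<in> Inert (fin_pattern E) \<longleftrightarrow>
    (ob, ar) \<in> Simp (nerve fin_ptd) 1 \<and> inert_map (ob 0) (ob 1) (ar (0, 1))"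
  and Active_fin_pattern: "(ob, ar) \<in> Active (fin_pattern E) \<longleftrightarrow>
    (ob, ar) \<in> Simp (nerve fin_ptd) 1 \<and> active_map (ob 0) (ob 1) (ar (0, 1))"
  and Elem_fin_pattern: "(ob, ar) \<in> Elem (fin_pattern E) \<longleftrightarrow>
    (ob, ar) \<in> Simp (nerve fin_ptd) 0 \<and> ob 0 \<in> E"
  by (simp_all add: fin_pattern_def)

lemma pattern_morphism_smash_nerve:
  assumes E: "\<And>m n. m \<in> E \<Longrightarrow> n \<in> E \<Longrightarrow> m * n \<in> E"
  shows "pattern_morphism (prod_pattern (fin_pattern E) (fin_pattern E)) (fin_pattern E) smash_nerve"
proof -
  note S = smap_simp[OF smap_smash_nerve]
  have H: "ar (0, 1) \<in> Hom fin_ptd (ob 0) (ob 1)" if "(ob, ar) \<in> Simp (nerve fin_ptd) 1" for ob ar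
    using that by (simp add: nerve_fin_iff)
  show ?thesis unfolding pattern_morphism_def image_subset_iff
  proof (intro conjI ballI)
    show "smap (Cat (prod_pattern (fin_pattern E) (fin_pattern E))) (Cat (fin_pattern E)) smash_nerve"
      by (simp add: smap_smash_nerve)
  next
    fix z assume z: "z \<in> Inert (prod_pattern (fin_pattern E) (fin_pattern E))"
    obtain ob ar ob' ar' where [simp]: "z = ((ob, ar), (ob', ar'))" by (metis surj_pair)
    show "smash_nerve 1 z \<in> Inert (fin_pattern E)"
      using z S[of z 1] H[of ob ar] H[of ob' ar']
      by (simp add: smash_nerve_Pair Inert_fin_pattern inert_smash_map)
  next
    fix z assume z: "z \<in> Active (prod_pattern (fin_pattern E) (fin_pattern E))"
    obtain ob ar ob' ar' where [simp]: "z = ((ob, ar), (ob', ar'))" by (metis surj_pair)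
    show "smash_nerve 1 z \<in> Active (fin_pattern E)"
      using z S[of z 1] H[of ob ar] H[of ob' ar']
      by (simp add: smash_nerve_Pair Active_fin_pattern active_smash_map)
  next
    fix z assume z: "z \<in> Elem (prod_pattern (fin_pattern E) (fin_pattern E))"
    obtain ob ar ob' ar' where [simp]: "z = ((ob, ar), (ob', ar'))" by (metis surj_pair)
    show "smash_nerve 0 z \<in> Elem (fin_pattern E)"
      using z S[of z 0] E by (simp add: smash_nerve_Pair Elem_fin_pattern)
  qed
qed


section \<open>Inert maps to the elementary object\<close>

text \<open>
  For \<open>k \<in> {1, \<dots>, m}\<close>, the inert map \<open>\<langle>m\<rangle> \<rightarrow> \<langle>1\<rangle>\<close> sending \<open>k\<close> to \<open>1\<close> and everything else to the base point.
\<close>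

definition pick :: "nat \<Rightarrow> nat \<Rightarrow> nat \<Rightarrow> nat" where
  "pick m k = (\<lambda>i\<in>{..m}. if i = k then 1 else 0)"

text \<open>
  The chain \<open>\<langle>m\<rangle> \<rightarrow> \<langle>1\<rangle> \<rightarrow> \<dots> \<rightarrow> \<langle>1\<rangle>\<close> whose first map is \<open>pick m k\<close> and whose other maps are
  identities.
\<close>

definition star :: "nat \<Rightarrow> nat \<Rightarrow> nat \<Rightarrow> fin_chain" where
  "star m n k = (\<lambda>i\<in>{..n}. if i = 0 then m else 1,
     \<lambda>(i, j)\<in>{(i, j). i \<le> j \<and> j \<le> n}.
       if j = 0 then (\<lambda>i\<in>{..m}. i) else if i = 0 then pick m k else (\<lambda>i\<in>{..1}. i))"

text \<open>
  The chain \<open>star m (Suc n) k\<close> as an \<open>n\<close>-simplex of \<open>el_under fin_flat \<langle>m\<rangle>\<close>, that is, together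
  with its face opposite to the vertex 0.
\<close>

definition star_under :: "nat \<Rightarrow> nat \<Rightarrow> nat \<Rightarrow> fin_chain \<times> fin_chain" where
  "star_under m n k =
    (Op (nerve fin_ptd) (Suc n) [1..<Suc (Suc n)] (star m (Suc n) k), star m (Suc n) k)"

lemma Op_nerve_closed:
  assumes \<theta>: "\<theta> \<in> simplex_ops m n" and x: "x \<in> Simp (nerve fin_ptd) n"
  shows "Op (nerve fin_ptd) n \<theta> x \<in> Simp (nerve fin_ptd) m"
proof -
  obtain ob ar where [simp]: "x = (ob, ar)" by fastforce
  have mono: "\<theta> ! i \<le> \<theta> ! j" if "i \<le> j" "j \<le> m" for i j
    using \<theta> that by (auto simp: simplex_ops_def sorted_iff_nth_mono)
  have le: "\<theta> ! j \<le> n" if "j \<le> m" for j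
    using \<theta> that by (auto simp: simplex_ops_def subset_iff)
  have len: "length \<theta> = Suc m" using \<theta> by (simp add: simplex_ops_def)
  have x': "\<forall>i j. i \<le> j \<and> j \<le> n \<longrightarrow> ar (i, j) \<in> Hom fin_ptd (ob i) (ob j)"
    "\<forall>i\<le>n. ar (i, i) = (\<lambda>k\<in>{..ob i}. k)"
    "\<forall>i j k. i \<le> j \<and> j \<le> k \<and> k \<le> n \<longrightarrow> ar (i, k) = compose {..ob i} (ar (j, k)) (ar (i, j))"
    using x unfolding \<open>x = _\<close> nerve_fin_iff by blast+
  have "ar (\<theta> ! i, \<theta> ! k) = compose {..ob (\<theta> ! i)} (ar (\<theta> ! j, \<theta> ! k)) (ar (\<theta> ! i, \<theta> ! j))"
    if "i \<le> j" "j \<le> k" "k \<le> m" for i j k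
    by (rule x'(3)[rule_format]) (use that mono le in auto)
  then show ?thesis
    using x'(1,2) by (auto simp: Op_nerve nerve_fin_iff len less_Suc_eq_le mono le)
qed

lemma pick_Hom: "1 \<le> k \<Longrightarrow> pick m k \<in> Hom fin_ptd m 1"
  by (auto simp: pick_def Hom_fin_ptd)

lemma id_Hom: "(\<lambda>i\<in>{..m}. i) \<in> Hom fin_ptd m m"
  by (auto simp: Hom_fin_ptd)

lemma inert_id: "inert_map m m (\<lambda>i\<in>{..m}. i)"
  unfolding inert_map_def by (rule bij_betw_byWitness[where f' = id]) auto

lemma inert_pick_iff:
  assumes f: "f \<in> Hom fin_ptd m 1"
  shows "inert_map m 1 f \<longleftrightarrow> (\<exists>k\<in>{1..m}. f = pick m k)"
proof
  assume "inert_map m 1 f"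
  then have b: "bij_betw f {i \<in> {..m}. f i \<noteq> 0} {1}" by (simp add: inert_map_def)
  then have "card {i \<in> {..m}. f i \<noteq> 0} = 1" using bij_betw_same_card[OF b] by simp
  then obtain k where k: "{i \<in> {..m}. f i \<noteq> 0} = {k}" by (auto simp: card_1_singleton_iff)
  then have "f k = 1" using b by (auto simp: bij_betw_def)
  then have "f i = pick m k i" for i
    using k f by (auto simp: pick_def Hom_fin_ptd extensional_def set_eq_iff)
  moreover have "k \<le> m" "k \<noteq> 0"
    using \<open>f k = 1\<close> k f by (auto simp: Hom_fin_ptd intro: Nat.gr0I)
  moreover from this have "k \<in> {1..m}" by simp
  ultimately show "\<exists>k\<in>{1..m}. f = pick m k" by blast
next
  assume "\<exists>k\<in>{1..m}. f = pick m k"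
  then obtain k where k: "k \<in> {1..m}" "f = pick m k" by blast
  then have "{i \<in> {..m}. f i \<noteq> 0} = {k}" by (auto simp: pick_def)
  then show "inert_map m 1 f" using k by (simp add: inert_map_def bij_betw_def pick_def)
qed

lemma pick_1: "pick 1 1 = (\<lambda>i\<in>{..1}. i)"
  by (auto simp: pick_def fun_eq_iff restrict_def)

lemma compose_Hom_id:
  assumes "f \<in> Hom fin_ptd m n"
  shows "compose {..m} f (\<lambda>i\<in>{..m}. i) = f" "compose {..m} (\<lambda>i\<in>{..n}. i) f = f"
  using assms by (auto simp: Hom_fin_ptd compose_def intro!: extensionalityI[of _ "{..m}"])

lemma star_simplex:
  assumes "1 \<le> k"
  shows "star m n k \<in> Simp (nerve fin_ptd) n"
proof -
  define ob where "ob i = (if i = 0 then m else 1)" for i :: nat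
  define ar where "ar i j = (if j = 0 then (\<lambda>i\<in>{..m}. i) else if i = 0 then pick m k
    else (\<lambda>i\<in>{..1}. i))" for i j :: nat
  have star: "star m n k =
      (\<lambda>i\<in>{..n}. ob i, \<lambda>(i, j)\<in>{(i, j). i \<le> j \<and> j \<le> n}. ar i j)"
    by (simp add: star_def ob_def ar_def)
  have H: "ar i j \<in> Hom fin_ptd (ob i) (ob j)" if "i \<le> j" for i j
    using that pick_Hom[OF assms, of m] id_Hom[of 1] id_Hom[of m] by (simp add: ob_def ar_def)
  have I: "ar i i = (\<lambda>k\<in>{..ob i}. k)" for i by (simp add: ob_def ar_def)
  have C: "ar i l = compose {..ob i} (ar j l) (ar i j)" if "i \<le> j" "j \<le> l" for i j l
  proof (cases "j = 0")
    case True
    then show ?thesis using I[of 0] compose_Hom_id(1)[OF H[of 0 l]] that by simp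
  next
    case False
    then have "ar j l = (\<lambda>i\<in>{..ob j}. i)" "ar i l = ar i j"
      using that by (simp_all add: ob_def ar_def)
    then show ?thesis using compose_Hom_id(2)[OF H[OF that(1)]] by simp
  qed
  have "(\<lambda>(i, j)\<in>{(i, j). i \<le> j \<and> j \<le> n}. ar i j) (i, l) =
      compose {..(\<lambda>i\<in>{..n}. ob i) i} ((\<lambda>(i, j)\<in>{(i, j). i \<le> j \<and> j \<le> n}. ar i j) (j, l))
        ((\<lambda>(i, j)\<in>{(i, j). i \<le> j \<and> j \<le> n}. ar i j) (i, j))"
    if "i \<le> j \<and> j \<le> l \<and> l \<le> n" for i j l
    using C[of i j l] that by simp
  then show ?thesis unfolding star nerve_fin_iff
    by (intro conjI allI impI) (simp_all add: H I)
qed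

lemma star_under_mem:
  assumes k: "k \<in> {1..m}" and z: "(ob, ar) \<in> Simp (nerve fin_ptd) 0" "ob 0 = m"
  shows "star_under m n k \<in> Simp (el_under fin_flat (ob, ar)) n"
proof -
  let ?t = "star m (Suc n) k" and ?N = "nerve fin_ptd"
  have t: "?t \<in> Simp ?N (Suc n)" using k by (intro star_simplex) auto
  have s: "Op ?N (Suc n) [1..<Suc (Suc n)] ?t \<in> Simp ?N n"
    by (rule Op_nerve_closed[OF simplex_opsI(3) t])
  \<comment> \<open>Every map of the chain is an identity or \<open>pick m k\<close>.\<close>
  have p: "inert_map m 1 (pick m k)" using k inert_pick_iff[OF pick_Hom, of k m] by auto
  have it: "Op ?N (Suc n) [i, j] ?t \<in> Inert fin_flat" if "i \<le> j" "j \<le> Suc n" for i j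
    using Op_nerve_closed[OF simplex_opsI(2)[OF that] t] that p
    by (auto simp: fin_flat_def Inert_fin_pattern star_def Op_nerve inert_id inert_id[of 1, simplified])
  have iu: "Op ?N n [i, j] (Op ?N (Suc n) [1..<Suc (Suc n)] ?t) \<in> Inert fin_flat"
    if "i \<le> j" "j \<le> n" for i j
    using Op_nerve_closed[OF simplex_opsI(2)[OF that] s] that
    by (auto simp: fin_flat_def Inert_fin_pattern star_def Op_nerve inert_id[of 1, simplified]
        simp del: upt_Suc)
  have es: "Op ?N n [i] (Op ?N (Suc n) [1..<Suc (Suc n)] ?t) \<in> Elem fin_flat" if "i \<le> n" for i
    using Op_nerve_closed[OF simplex_opsI(1)[OF that] s] that
    by (auto simp: fin_flat_def Elem_fin_pattern star_def Op_nerve simp del: upt_Suc)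
  have "Op ?N (Suc n) [0] ?t = (ob, ar)"
    using z by (auto simp: Op_nerve star_def nerve_fin_iff fun_eq_iff restrict_def extensional_def)
  then show ?thesis
    using t s it iu es by (auto simp: star_under_def Simp_el_under Simp_el_cat Simp_int_cat
        fin_flat_def simp del: upt_Suc)
qed

text \<open>
  There are no simplices of \<open>el_under fin_flat \<langle>m\<rangle>\<close> other than the \<open>star_under\<close>: all objects after
  the vertex \<open>\<langle>m\<rangle>\<close> are \<open>\<langle>1\<rangle>\<close>, all maps between them are inert endomorphisms of \<open>\<langle>1\<rangle>\<close> and hence
  identities, and therefore all maps out of \<open>\<langle>m\<rangle>\<close> agree with the first one, which is inert.
\<close>

lemma el_under_fin_flat_cases:
  assumes x: "x \<in> Simp (el_under fin_flat (ob, ar)) n"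
  obtains k where "k \<in> {1..ob 0}" "x = star_under (ob 0) n k"
proof -
  let ?N = "nerve fin_ptd" and ?m = "ob 0"
  obtain s o' a where x': "x = (s, (o', a))" by (metis surj_pair)
  have C: "Cat fin_flat = ?N" by (simp add: fin_flat_def)
  have t: "(o', a) \<in> Simp ?N (Suc n)" and z: "Op ?N (Suc n) [0] (o', a) = (ob, ar)"
    and s: "s = Op ?N (Suc n) [1..<Suc (Suc n)] (o', a)"
    and i: "\<And>i j. i \<le> j \<Longrightarrow> j \<le> Suc n \<Longrightarrow> Op ?N (Suc n) [i, j] (o', a) \<in> Inert fin_flat"
    and e: "\<And>i. i \<le> n \<Longrightarrow> Op ?N n [i] s \<in> Elem fin_flat"
    using x unfolding x' Simp_el_under Simp_el_cat Simp_int_cat C by blast+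
  have "fst (Op ?N (Suc n) [0] (o', a)) 0 = ?m" unfolding z by simp
  then have o0: "o' 0 = ?m" by (simp add: Op_nerve)
  have o1: "o' (Suc i) = 1" if "i \<le> n" for i
    using e[OF that] that unfolding s
    by (simp add: fin_flat_def Op_nerve Elem_fin_pattern del: upt_Suc)
  have inert: "inert_map (o' i) (o' j) (a (i, j))" if "i \<le> j" "j \<le> Suc n" for i j
    using i[OF that] by (simp add: fin_flat_def Op_nerve Inert_fin_pattern)
  have H: "a (i, j) \<in> Hom fin_ptd (o' i) (o' j)" if "i \<le> j" "j \<le> Suc n" for i j
    using t that by (simp add: nerve_fin_iff)
  have "inert_map ?m 1 (a (0, 1))" "a (0, 1) \<in> Hom fin_ptd ?m 1"
    using inert[of 0 1] H[of 0 1] o0 o1[of 0] by simp_all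
  then obtain k where k: "k \<in> {1..?m}" "a (0, 1) = pick ?m k" using inert_pick_iff by blast
  \<comment> \<open>An inert map \<open>\<langle>1\<rangle> \<rightarrow> \<langle>1\<rangle>\<close> is \<open>pick 1 1\<close>, the identity.\<close>
  have a1: "a (Suc i, Suc j) = (\<lambda>i\<in>{..1}. i)" if "i \<le> j" "j \<le> n" for i j
  proof -
    have "inert_map 1 1 (a (Suc i, Suc j))" "a (Suc i, Suc j) \<in> Hom fin_ptd 1 1"
      using inert[of "Suc i" "Suc j"] H[of "Suc i" "Suc j"] o1[of i] o1[of j] that by simp_all
    then show ?thesis using inert_pick_iff[of _ 1] pick_1 by auto
  qed
  have a0: "a (0, Suc j) = pick ?m k" if "j \<le> n" for j
  proof -
    have "\<forall>i j k. i \<le> j \<and> j \<le> k \<and> k \<le> Suc n \<longrightarrow>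
        a (i, k) = compose {..o' i} (a (j, k)) (a (i, j))"
      using t unfolding nerve_fin_iff by blast
    from this[rule_format, of 0 1 "Suc j"]
    have "a (0, Suc j) = compose {..?m} (a (1, Suc j)) (a (0, 1))" using that o0 by simp
    also have "a (1, Suc j) = (\<lambda>i\<in>{..1}. i)" using a1[of 0 j] that by simp
    also have "compose {..?m} (\<lambda>i\<in>{..1}. i) (a (0, 1)) = pick ?m k"
      unfolding k(2) by (rule ext) (simp add: compose_def pick_def)
    finally show ?thesis .
  qed
  have "o' = fst (star ?m (Suc n) k)"
  proof
    fix i
    have "o' i = undefined" if "\<not> i \<le> Suc n"
      using t that by (auto simp: nerve_fin_iff extensional_def)
    then show "o' i = fst (star ?m (Suc n) k) i"
      using o0 o1 by (cases i) (auto simp: star_def)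
  qed
  moreover have "a = snd (star ?m (Suc n) k)"
  proof
    fix p :: "nat \<times> nat"
    obtain i j where p: "p = (i, j)" by fastforce
    consider "\<not> (i \<le> j \<and> j \<le> Suc n)" | "i = 0" "j = 0" | j' where "i = 0" "j = Suc j'" "j' \<le> n"
      | i' j' where "i = Suc i'" "j = Suc j'" "i' \<le> j'" "j' \<le> n"
      by (cases i; cases j) auto
    then show "a p = snd (star ?m (Suc n) k) p"
    proof cases
      case 1
      then have "a p = undefined" using t p by (auto simp: nerve_fin_iff extensional_def)
      then show ?thesis using 1 p by (auto simp: star_def)
    next
      case 2
      then have "a p = (\<lambda>i\<in>{..?m}. i)" using t p o0 by (auto simp: nerve_fin_iff)
      then show ?thesis using 2 p by (auto simp: star_def)
    qed (use p a0 a1 in \<open>auto simp: star_def\<close>)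
  qed
  ultimately have "(o', a) = star ?m (Suc n) k" by (simp add: prod_eq_iff)
  then show ?thesis using that[OF k(1)] by (simp add: x' s star_under_def)
qed

lemma star_under_inject:
  assumes "k \<in> {1..m}" "star_under m n k = star_under m n k'"
  shows "k = k'"
proof -
  \<comment> \<open>The edge from the vertex 0 to the vertex 1 recovers the picked element.\<close>
  have edge: "snd (star m (Suc n) l) (0, 1) = pick m l" for l by (simp add: star_def)
  have "star m (Suc n) k = star m (Suc n) k'" using assms(2) by (simp add: star_under_def)
  then have "pick m k = pick m k'" using edge by metis
  then have "pick m k k = pick m k' k" by simp
  moreover have "pick m k k = 1" "pick m k' k = (if k = k' then 1 else 0)"
    using assms(1) by (simp_all add: pick_def)
  ultimately show ?thesis by (cases "k = k'") simp_all
qed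

lemma bij_betw_star_under:
  assumes "(ob, ar) \<in> Simp (nerve fin_ptd) 0"
  shows "bij_betw (star_under (ob 0) n) {1..ob 0} (Simp (el_under fin_flat (ob, ar)) n)"
  unfolding bij_betw_def
proof
  show "inj_on (star_under (ob 0) n) {1..ob 0}"
    by (rule inj_onI) (rule star_under_inject)
  show "star_under (ob 0) n ` {1..ob 0} = Simp (el_under fin_flat (ob, ar)) n"
    by (blast intro: star_under_mem[OF _ assms refl] elim: el_under_fin_flat_cases)
qed

lemma smash_map_pick:
  assumes "1 \<le> i" "i \<le> m" "1 \<le> j" "j \<le> n"
  shows "smash_map m n 1 (pick m i) (pick n j) = pick (m * n) (smash_pair n i j)"
proof (rule smash_ext)
  fix i' j' assume *: "i' \<le> m" "j' \<le> n"
  have "pick m i 0 = 0" "pick n j 0 = 0" using assms by (auto simp: pick_def)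
  then have "smash_map m n 1 (pick m i) (pick n j) (smash_pair n i' j') =
      (if i' = i \<and> j' = j then 1 else 0)"
    using * by (subst smash_map_pair) (auto simp: pick_def smash_pair_def)
  also have "\<dots> = pick (m * n) (smash_pair n i j) (smash_pair n i' j')"
    using * assms smash_pair_eq_iff[of j' n j i' i] smash_pair_le[of i' m j' n]
    by (simp add: pick_def)
  finally show "smash_map m n 1 (pick m i) (pick n j) (smash_pair n i' j') =
      pick (m * n) (smash_pair n i j) (smash_pair n i' j')" .
qed (auto simp: smash_map_ext pick_def)

lemma smash_nerve_star:
  assumes "1 \<le> i" "i \<le> m" "1 \<le> j" "j \<le> m'"
  shows "smash_nerve n (star m n i, star m' n j) = star (m * m') n (smash_pair m' i j)"
proof -
  have "smash_map 1 1 1 (\<lambda>i\<in>{..1}. i) (\<lambda>i\<in>{..1}. i) = (\<lambda>i\<in>{..1}. i)"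
    using smash_map_id[of 1 1] by simp
  then show ?thesis
    unfolding star_def smash_nerve_Pair prod.inject using smash_map_pick[OF assms]
    by (intro conjI restrict_ext) (auto simp: smash_map_id)
qed

definition smash_under :: "nat \<Rightarrow> (fin_chain \<times> fin_chain) \<times> (fin_chain \<times> fin_chain) \<Rightarrow>
    fin_chain \<times> fin_chain" where
  "smash_under n x = el_under_map smash_nerve n (interchange n x)"

lemma smash_under_star_under:
  assumes "1 \<le> i" "i \<le> m" "1 \<le> j" "j \<le> m'"
  shows "smash_under n (star_under m n i, star_under m' n j) =
    star_under (m * m') n (smash_pair m' i j)"
proof -
  have "(star m (Suc n) i, star m' (Suc n) j) \<in> Simp (prod_sset (nerve fin_ptd) (nerve fin_ptd)) (Suc n)"
    using assms by (simp add: star_simplex)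
  from smap_op[OF smap_smash_nerve simplex_opsI(3) this]
  show ?thesis
    by (simp add: smash_under_def interchange_def el_under_map_def star_under_def
        smash_nerve_star[OF assms] del: upt_Suc)
qed

text \<open>
  Under the parametrizations by \<open>star_under\<close>, the map \<open>smash_under\<close> becomes the bijection
  \<open>smash_pair\<close> from pairs of nonzero elements to nonzero elements.
\<close>

lemma sset_iso_smash_under:
  assumes z: "z \<in> Simp (nerve fin_ptd) 0" and w: "w \<in> Simp (nerve fin_ptd) 0"
  shows "sset_iso (prod_sset (el_under fin_flat z) (el_under fin_flat w))
    (el_under fin_flat (smash_nerve 0 (z, w))) smash_under"
proof -
  obtain ob ar ob' ar' where zw: "z = (ob, ar)" "w = (ob', ar')" by (metis surj_pair)
  obtain ob'' ar'' where sm: "smash_nerve 0 (z, w) = (ob'', ar'')" by fastforce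
  have ob'': "ob'' 0 = ob 0 * ob' 0" using sm by (auto simp: zw smash_nerve_Pair)
  have "(ob'', ar'') \<in> Simp (nerve fin_ptd) 0"
    using smap_simp[OF smap_smash_nerve, of "(z, w)" 0] z w sm by simp
  note b = bij_betw_star_under[OF this]
  have "bij_betw (smash_under n) (Simp (el_under fin_flat z) n \<times> Simp (el_under fin_flat w) n)
      (Simp (el_under fin_flat (smash_nerve 0 (z, w))) n)" for n
  proof -
    let ?I = "{1..ob 0} \<times> {1..ob' 0}" and ?f = "map_prod (star_under (ob 0) n) (star_under (ob' 0) n)"
    have f: "bij_betw ?f ?I (Simp (el_under fin_flat z) n \<times> Simp (el_under fin_flat w) n)"
      using z w unfolding zw by (intro bij_betw_map_prod bij_betw_star_under)
    have "bij_betw (star_under (ob'' 0) n \<circ> case_prod (smash_pair (ob' 0))) ?I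
        (Simp (el_under fin_flat (smash_nerve 0 (z, w))) n)"
      using bij_betw_trans[OF bij_betw_smash_pair[of "ob' 0" "ob 0"]] b[of n] unfolding sm ob'' by blast
    moreover have "(star_under (ob'' 0) n \<circ> case_prod (smash_pair (ob' 0))) p = (smash_under n \<circ> ?f) p"
      if "p \<in> ?I" for p
      using that by (auto simp: smash_under_star_under ob'')
    ultimately have "bij_betw (smash_under n \<circ> ?f) ?I
        (Simp (el_under fin_flat (smash_nerve 0 (z, w))) n)"
      using bij_betw_cong[of ?I] by blast
    then show ?thesis using bij_betw_comp_iff[OF f] by blast
  qed
  moreover have "smap (prod_sset (el_under fin_flat z) (el_under fin_flat w))
      (el_under fin_flat (smash_nerve 0 (z, w))) smash_under"
  proof -
    have "pattern_morphism (prod_pattern fin_flat fin_flat) fin_flat smash_nerve"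
      unfolding fin_flat_def by (rule pattern_morphism_smash_nerve) simp
    note smap_el_under[OF this, of "(z, w)"]
    moreover have "smap (prod_sset (el_under fin_flat z) (el_under fin_flat w))
        (el_under (prod_pattern fin_flat fin_flat) (z, w)) interchange"
      using sset_iso_interchange[of fin_flat z fin_flat w] by (simp add: sset_iso_def)
    ultimately show ?thesis unfolding smash_under_def by (rule smap_comp[rotated])
  qed
  ultimately show ?thesis by (simp add: sset_iso_def)
qed


section \<open>Products of enrichable patterns\<close>

lemma pattern_morphism_smash_structure:
  assumes "pattern_morphism P (fin_pattern E) F" "pattern_morphism Q (fin_pattern E) G"
    and "\<And>m n. m \<in> E \<Longrightarrow> n \<in> E \<Longrightarrow> m * n \<in> E"
  shows "pattern_morphism (prod_pattern P Q) (fin_pattern E) (smash_structure F G)"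
proof -
  have "smash_structure F G = (\<lambda>n x. smash_nerve n (map_prod (F n) (G n) x))"
    by (auto simp: smash_structure_def fun_eq_iff)
  then show ?thesis
    using pattern_morphism_comp[OF pattern_morphism_map_prod[OF assms(1,2)]
        pattern_morphism_smash_nerve[OF assms(3)]] by simp
qed

text \<open>
  The comparison map of the product is the product of the comparison maps of \<open>P\<close> and \<open>Q\<close>,
  conjugated by \<open>interchange\<close> at the source and by \<open>smash_under\<close> at the target.
\<close>

lemma cartesian_pattern_prod:
  assumes P: "cartesian_pattern P F" and Q: "cartesian_pattern Q G"
  shows "cartesian_pattern (prod_pattern P Q) (smash_structure F G)"
proof -
  have FG: "pattern_morphism P fin_flat F" "pattern_morphism Q fin_flat G"
    using P Q by (simp_all add: cartesian_pattern_def)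
  have FGn: "smap (Cat P) (nerve fin_ptd) F" "smap (Cat Q) (nerve fin_ptd) G"
    using FG by (simp_all add: pattern_morphism_def fin_flat_def)
  have S: "pattern_morphism (prod_pattern P Q) fin_flat (smash_structure F G)"
    using FG unfolding fin_flat_def by (intro pattern_morphism_smash_structure) auto
  have "equivalence_of_qcats (el_under (prod_pattern P Q) (x, y))
      (el_under fin_flat (smash_structure F G 0 (x, y))) (el_under_map (smash_structure F G))"
    if x: "x \<in> Simp (Cat P) 0" and y: "y \<in> Simp (Cat Q) 0" for x y
  proof (rule equivalence_of_qcats_conjugate)
    show "equivalence_of_qcats (prod_sset (el_under P x) (el_under Q y))
        (prod_sset (el_under fin_flat (F 0 x)) (el_under fin_flat (G 0 y)))
        (\<lambda>n. map_prod (el_under_map F n) (el_under_map G n))"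
      using P Q x y by (intro equivalence_of_qcats_prod) (simp_all add: cartesian_pattern_def)
    show "sset_iso (prod_sset (el_under P x) (el_under Q y))
        (el_under (prod_pattern P Q) (x, y)) interchange"
      by (rule sset_iso_interchange)
    show "sset_iso (prod_sset (el_under fin_flat (F 0 x)) (el_under fin_flat (G 0 y)))
        (el_under fin_flat (smash_structure F G 0 (x, y))) smash_under"
      using sset_iso_smash_under[OF smap_simp[OF FGn(1) x] smap_simp[OF FGn(2) y]]
      by (simp add: smash_structure_def)
    show "smap (el_under (prod_pattern P Q) (x, y))
        (el_under fin_flat (smash_structure F G 0 (x, y))) (el_under_map (smash_structure F G))"
      by (rule smap_el_under[OF S])
  qed (auto simp: interchange_def smash_under_def el_under_map_def smash_structure_def)
  then show ?thesis
    using P Q S by (auto simp: cartesian_pattern_def algebraic_pattern_prod)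
qed

text \<open>
  An elementary object of \<open>P \<times> Q\<close> lies over \<open>\<langle>m * n\<rangle>\<close>, where its components lie over \<open>\<langle>m\<rangle>\<close> and
  \<open>\<langle>n\<rangle>\<close>; a product of natural numbers is 1 only if both factors are.
\<close>

lemma flat_prod:
  assumes F: "pattern_morphism P fin_natural F" and G: "pattern_morphism Q fin_natural G"
  shows "flat (prod_pattern P Q) (smash_structure F G) = prod_pattern (flat P F) (flat Q G)"
proof -
  have smash: "smash_nerve 0 (z, w) \<in> Elem fin_flat \<longleftrightarrow> z \<in> Elem fin_flat \<and> w \<in> Elem fin_flat"
    if z: "z \<in> Elem fin_natural" and w: "w \<in> Elem fin_natural" for z w
  proof -
    obtain ob ar ob' ar' where zw: "z = (ob, ar)" "w = (ob', ar')" by (metis surj_pair)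
    have N: "z \<in> Simp (nerve fin_ptd) 0" "w \<in> Simp (nerve fin_ptd) 0"
      using z w by (auto simp: zw fin_natural_def Elem_fin_pattern)
    then show ?thesis
      using smap_simp[OF smap_smash_nerve, of "(z, w)" 0]
      by (simp add: zw smash_nerve_Pair fin_flat_def Elem_fin_pattern)
  qed
  have "smash_structure F G 0 (x, y) \<in> Elem fin_flat \<longleftrightarrow>
      F 0 x \<in> Elem fin_flat \<and> G 0 y \<in> Elem fin_flat" if "x \<in> Elem P" "y \<in> Elem Q" for x y
    unfolding smash_structure_def case_prod_conv
    using F G that by (intro smash) (auto simp: pattern_morphism_def)
  then have "{x \<in> Elem P \<times> Elem Q. smash_structure F G 0 x \<in> Elem fin_flat} =
      {x \<in> Elem P. F 0 x \<in> Elem fin_flat} \<times> {y \<in> Elem Q. G 0 y \<in> Elem fin_flat}"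
    by auto
  then show ?thesis by (simp add: flat_def prod_pattern_def)
qed

lemma pattern_equivalence_refl: "algebraic_pattern P \<Longrightarrow> pattern_equivalence P P (\<lambda>n x. x)"
  unfolding pattern_equivalence_def inverse_equivalences_def pattern_morphism_def
  using smap_id naturally_equivalent_refl by blast

theorem lemma3p4p3:
  fixes P :: "'a pattern" and Q :: "'b pattern"
    and F :: "nat \<Rightarrow> 'a \<Rightarrow> fin_chain" and G :: "nat \<Rightarrow> 'b \<Rightarrow> fin_chain"
  assumes "enrichable_pattern P F" and "enrichable_pattern Q G"
  shows "enrichable_pattern (prod_pattern P Q) (smash_structure F G) \<and>
    pattern_equivalence (flat (prod_pattern P Q) (smash_structure F G))
      (prod_pattern (flat P F) (flat Q G)) (\<lambda>n x. x)"
proof -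
  have FG: "pattern_morphism P fin_natural F" "pattern_morphism Q fin_natural G"
    using assms by (simp_all add: enrichable_pattern_def)
  have cart: "cartesian_pattern (prod_pattern (flat P F) (flat Q G)) (smash_structure F G)"
    using assms by (intro cartesian_pattern_prod) (simp_all add: enrichable_pattern_def)
  have "pattern_morphism (prod_pattern P Q) fin_natural (smash_structure F G)"
    using FG unfolding fin_natural_def by (intro pattern_morphism_smash_structure) auto
  moreover have "pattern_equivalence (prod_pattern (flat P F) (flat Q G))
      (prod_pattern (flat P F) (flat Q G)) (\<lambda>n x. x)"
    using cart by (intro pattern_equivalence_refl) (simp add: cartesian_pattern_def)
  ultimately show ?thesis
    using assms cart by (simp add: enrichable_pattern_def flat_prod[OF FG] algebraic_pattern_prod)
qed

end
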